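(* Let $A$ be a Banach algebra that has a left approximate identity $\{e_\lambda\}_{\lambda\in\Lambda}$ of bound $M\geq1$, let $X$ be a Banach space, and let $\pi$ be a continuous representation of $A$ on $X$. Let $S$ be a non-empty subset of $X$ such that $\lim_\lambda\pi(e_\lambda)s=s$ uniformly on $S$, and suppose that $S$ is bounded or that $\{e_\lambda\}_{\lambda\in\Lambda}$ is commutative. Let $\Omega$ be a non-empty set, and let $X'$ be a Banach space of bounded maps from $\Omega$ into $X$, supplied with the supremum norm. Suppose that $X'$ is invariant under the natural pointwise action of $A$ on $X$-valued maps on $\Omega$, so that there is a natural continuous representation $\pi'$ of $A$ on $X'$, given by $[\pi'(a)f](\omega)=\pi(a)[f(\omega)]$ for $a\in A$, $f\in X'$, $\omega\in\Omega$. Choose a unital Banach superalgebra $B$ of $A$ such that $\pi'$ extends to a continuous unital representation, again denoted by $\pi'$, of $B$ on $X'$. Let $S'$ be the set of all $f\in X'$ such that $f(\Omega)\subset S$, and assume that $S'$ is non-empty. Then, for every $\epsilon>0$, every $\delta>0$, every $r$ with $0<r<(M+1)^{-1}$, every integer $n_0\geq1$, and every sequence $\{\alpha_n\}_{n=1}^\infty$ in $(1,\infty)$ with $\lim_{n\to\infty}\alpha_n=\infty$, there exists a simultaneous power factorization $(a,(x_n)_{n\geq1})$ (in the sense defined in the context) for $\sigma=\pi'$ on $Y=X'$, the set $T=S'$, the superalgebra $B$ and the parameters $\epsilon,\delta,r,n_0,\{\alpha_n\}$.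
   Context: All algebras and vector spaces are over $\mathbb F=\mathbb R$ or $\mathbb C$. Unit elements of unital normed algebras have norm $1$. A left approximate identity of bound $M$ for $A$ is a net $\{e_\lambda\}$ in $A$ with $\|e_\lambda\|\leq M$ and $\lim_\lambda e_\lambda a=a$ for all $a\in A$; it is commutative if its elements commute pairwise. A continuous representation on $X$ is a norm-continuous algebra homomorphism into the bounded operators on $X$; it is unital if it maps the unit to the identity operator. Uniform convergence $\lim_\lambda\pi(e_\lambda)s=s$ on $S$: for every $\eta>0$ there is $\lambda_0$ with $\|\pi(e_\lambda)s-s\|<\eta$ for all $\lambda\geq\lambda_0$, $s\in S$. A unital Banach superalgebra $B$ of $A$ is a unital Banach algebra containing $A$ as a closed subalgebra with the restricted norm. Definition (simultaneous power factorization). Let $A$ be a Banach algebra with left approximate identity $\{e_\lambda\}_{\lambda\in\Lambda}$ of bound $M\ge1$, $B$ a unital Banach superalgebra of $A$, $\sigma$ a continuous unital representation of $B$ on a Banach space $Y$, $T\subset Y$ non-empty, $\epsilon,\delta>0$, $0<r<(M+1)^{-1}$, $n_0\geq 1$ an integer, $\{\alpha_n\}$ a sequence in $(1,\infty)$ tending to $\infty$. A simultaneous power factorization for these data consists of $a\in A$ and maps $x_n:T\to Y$ ($n\geq 1$) such that: (1) $s=\sigma(a^n)x_n(s)$ for all $n\geq 1$, $s\in T$; (2) $\|a\|\leq M$; (3) for all $n\geq1$, $x_n$ is a uniformly continuous homeomorphism of $T$ onto $x_n(T)$, with the restricted map $\sigma(a^n):x_n(T)\to T$ as its inverse; (4)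 (a) $\|s-x_n(s)\|\leq\epsilon$ for $1\leq n\leq n_0$ and $s\in T$; (b) $\|x_n(s)\|\leq\alpha_n^n\max(\|s\|,\delta)$ for all $n\geq1$, $s\in T$; (5) (a) if $s_1,s_2,s_1+s_2\in T$, then $x_n(s_1+s_2)=x_n(s_1)+x_n(s_2)$ for all $n\geq 1$; (b) if $\mu\in\mathbb F$ and $s,\mu s\in T$, then $x_n(\mu s)=\mu x_n(s)$ for all $n\geq 1$; (6) there is a sequence $\{u_i\}_{i=1}^\infty$ in $\{e_\lambda:\lambda\in\Lambda\}$ such that: (a) $a=\sum_{i=1}^\infty r(1-r)^{i-1}u_i$, an element of the closed convex hull of $\{u_i:i\geq1\}$ in $A$; (b) for every $k\geq0$, $b_k=(1-r)^k1_B+\sum_{i=1}^kr(1-r)^{i-1}u_i$ is an element of the convex hull of $\{1_B,u_1,\ldots,u_k\}$ that is invertible in $B$, $b_k^{-1}$ lies in the unital Banach subalgebra of $B$ generated by $\{u_1,\ldots,u_k\}$ (smallest closed subalgebra containing these and $1_B$), and $x_n(s)=\lim_{k\to\infty}\sigma(b_k^{-n})s$ for all $n\geq1$, $s\in T$; (c) there is a chain $\lambda_1\leq\lambda_2\leq\ldots$ in $\Lambda$ with $u_k=e_{\lambda_k}$ for all $k\geq1$, where moreover $\lambda_1<\lambda_2<\ldots$ can be required if $\Lambda$ has no largest element; (7) (a) if $T$ is bounded, so is $x_n(T)$ for all $n\geq1$; (b) if $T$ is totally bounded, so is $x_n(T)$ for all $n\geq1$; (c) $\lim_\lambda\sigma(e_\lambda)x_n(s)=x_n(s)$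 uniformly on $T$ for all $n\geq1$. *)

theory Defs
  imports "HOL-Analysis.Analysis"
begin

text \<open>
  Scalars: the field is a type variable of class \<^class>\<open>real_normed_field\<close>. Norms of such fields
  are multiplicative, so by Gelfand--Mazur these are, up to isometric isomorphism, exactly the
  real and the complex numbers, and both types are instances. The library's Banach space classes
  are real; the scalar multiplication is therefore an explicit parameter, required to extend the
  real one and to be compatible with the norm.
\<close>

locale normed_space_over = vector_space scale
  for scale :: "'k::real_normed_field \<Rightarrow> 'v::real_normed_vector \<Rightarrow> 'v" +
  assumes norm_scale: "norm (scale c v) = norm c * norm v"
    and scale_of_real: "scale (of_real t) v = t *\<^sub>R v"

locale normed_algebra_over = normed_space_over scale
  for scale :: "'k::real_normed_field \<Rightarrow> 'b::real_normed_algebra \<Rightarrow> 'b" +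
  assumes mult_scale_left: "scale c x * y = scale c (x * y)"
    and mult_scale_right: "x * scale c y = scale c (x * y)"

definition closed_subalgebra ::
  "('k::real_normed_field \<Rightarrow> 'b::real_normed_algebra \<Rightarrow> 'b) \<Rightarrow> 'b set \<Rightarrow> bool"
  where "closed_subalgebra sb C \<longleftrightarrow>
    closed C \<and> module.subspace sb C \<and> (\<forall>x\<in>C. \<forall>y\<in>C. x * y \<in> C)"

text \<open>The smallest closed subalgebra containing \<open>G\<close> and the unit.\<close>

definition unital_closed_subalgebra_generated ::
  "('k::real_normed_field \<Rightarrow> 'b::real_normed_algebra_1 \<Rightarrow> 'b) \<Rightarrow> 'b set \<Rightarrow> 'b set"
  where "unital_closed_subalgebra_generated sb G =
    (\<lambda>C. closed_subalgebra sb C \<and> 1 \<in> C) hull G"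

text \<open>
  A continuous representation of the subalgebra \<open>A\<close> (values of \<open>\<pi>\<close> outside \<open>A\<close> are irrelevant).
  Elements of \<open>'v \<Rightarrow>\<^sub>L 'v\<close> are only real-linear, so linearity of each operator over the scalar
  field is required separately.
\<close>

definition continuous_representation ::
  "('k::real_normed_field \<Rightarrow> 'b::real_normed_algebra \<Rightarrow> 'b) \<Rightarrow> 'b set \<Rightarrow>
   ('k \<Rightarrow> 'v::real_normed_vector \<Rightarrow> 'v) \<Rightarrow> ('b \<Rightarrow> 'v \<Rightarrow>\<^sub>L 'v) \<Rightarrow> bool"
  where "continuous_representation sb A sv \<pi> \<longleftrightarrow>
    (\<forall>a\<in>A. \<forall>c v. blinfun_apply (\<pi> a) (sv c v) = sv c (blinfun_apply (\<pi> a) v)) \<and>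
    (\<forall>a\<in>A. \<forall>b\<in>A. \<pi> (a + b) = \<pi> a + \<pi> b) \<and>
    (\<forall>a\<in>A. \<forall>c v. blinfun_apply (\<pi> (sb c a)) v = sv c (blinfun_apply (\<pi> a) v)) \<and>
    (\<forall>a\<in>A. \<forall>b\<in>A. \<pi> (a * b) = \<pi> a o\<^sub>L \<pi> b) \<and>
    continuous_on A \<pi>"

definition continuous_unital_representation ::
  "('k::real_normed_field \<Rightarrow> 'b::real_normed_algebra_1 \<Rightarrow> 'b) \<Rightarrow>
   ('k \<Rightarrow> 'v::real_normed_vector \<Rightarrow> 'v) \<Rightarrow> ('b \<Rightarrow> 'v \<Rightarrow>\<^sub>L 'v) \<Rightarrow> bool"
  where "continuous_unital_representation sb sv \<sigma> \<longleftrightarrow>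
    continuous_representation sb UNIV sv \<sigma> \<and> \<sigma> 1 = id_blinfun"

text \<open>
  Index sets of nets are directed preorders. The library's \<^const>\<open>at_top\<close> needs a partial order,
  so the filter of tails is introduced here; the lemma below gives its usual description.
\<close>

definition directed_index :: "'i::preorder itself \<Rightarrow> bool"
  where "directed_index _ \<longleftrightarrow> (\<forall>i j::'i. \<exists>k. i \<le> k \<and> j \<le> k)"

definition net_filter :: "'i::preorder filter"
  where "net_filter = (INF i. principal {i..})"

lemma eventually_net_filter:
  assumes "directed_index TYPE('i::preorder)"
  shows "eventually P (net_filter :: 'i filter) \<longleftrightarrow> (\<exists>i0. \<forall>i\<ge>i0. P i)"
proof -
  have "eventually P (net_filter :: 'i filter) \<longleftrightarrow> (\<exists>i0\<in>UNIV. eventually P (principal {i0..}))"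
    unfolding net_filter_def
  proof (rule eventually_INF_base)
    fix i j :: 'i
    obtain k where "i \<le> k" "j \<le> k"
      using assms unfolding directed_index_def by blast
    then show "\<exists>k\<in>UNIV. principal {k..} \<le> inf (principal {i..}) (principal {j..})"
      by (auto intro: order_trans)
  qed simp
  then show ?thesis by (auto simp: eventually_principal)
qed

definition bounded_left_approximate_identity ::
  "'b::real_normed_algebra set \<Rightarrow> ('i::preorder \<Rightarrow> 'b) \<Rightarrow> real \<Rightarrow> bool"
  where "bounded_left_approximate_identity A e M \<longleftrightarrow>
    directed_index TYPE('i) \<and>
    (\<forall>i. e i \<in> A \<and> norm (e i) \<le> M) \<and>
    (\<forall>a\<in>A. ((\<lambda>i. e i * a) \<longlongrightarrow> a) net_filter)"

text \<open>
  The Banach space \<open>'y\<close> is a space of bounded maps \<open>'w \<Rightarrow> 'x\<close> with pointwise operations and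
  supremum norm: \<open>ev f\<close> is the map that \<open>f\<close> stands for.
\<close>

definition sup_normed_space_of_bounded_maps ::
  "('k::real_normed_field \<Rightarrow> 'x::real_normed_vector \<Rightarrow> 'x) \<Rightarrow>
   ('k \<Rightarrow> 'y::real_normed_vector \<Rightarrow> 'y) \<Rightarrow> ('y \<Rightarrow> 'w \<Rightarrow> 'x) \<Rightarrow> bool"
  where "sup_normed_space_of_bounded_maps sx sy ev \<longleftrightarrow>
    inj ev \<and>
    (\<forall>f g w. ev (f + g) w = ev f w + ev g w) \<and>
    (\<forall>c f w. ev (sy c f) w = sx c (ev f w)) \<and>
    (\<forall>f. bounded (range (ev f))) \<and>
    (\<forall>f. norm f = (SUP w. norm (ev f w)))"

text \<open>
  Sequences indexed by \<open>n \<ge> 1\<close> are functions on \<^typ>\<open>nat\<close> whose value at \<open>0\<close> is irrelevant.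
  As \<open>A\<close> need not have a unit, the powers \<open>a ^ n\<close> are taken in the unital superalgebra
  \<open>'b\<close>, which contains \<open>A\<close> as a subset.
\<close>

definition convex_partial_sum :: "real \<Rightarrow> (nat \<Rightarrow> 'b::real_normed_algebra_1) \<Rightarrow> nat \<Rightarrow> 'b"
  where "convex_partial_sum r u k =
    (1 - r) ^ k *\<^sub>R 1 + (\<Sum>i=1..k. (r * (1 - r) ^ (i - 1)) *\<^sub>R u i)"

locale simultaneous_power_factorization =
  fixes sb :: "'k::real_normed_field \<Rightarrow> 'b::{real_normed_algebra_1, banach} \<Rightarrow> 'b"
    and sy :: "'k \<Rightarrow> 'y::banach \<Rightarrow> 'y"
    and A :: "'b set"
    and e :: "'i::preorder \<Rightarrow> 'b"
    and M :: real
    and \<sigma> :: "'b \<Rightarrow> 'y \<Rightarrow>\<^sub>L 'y"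
    and T :: "'y set"
    and \<epsilon> \<delta> r :: real
    and n0 :: nat
    and \<alpha> :: "nat \<Rightarrow> real"
    and a :: 'b
    and x :: "nat \<Rightarrow> 'y \<Rightarrow> 'y"
  assumes in_algebra: "a \<in> A"
    and factorization: "\<And>n s. n \<ge> 1 \<Longrightarrow> s \<in> T \<Longrightarrow> s = blinfun_apply (\<sigma> (a ^ n)) (x n s)"
    and norm_le: "norm a \<le> M"
    and unif_cont: "\<And>n. n \<ge> 1 \<Longrightarrow> uniformly_continuous_on T (x n)"
    and homeo: "\<And>n. n \<ge> 1 \<Longrightarrow> homeomorphism T (x n ` T) (x n) (blinfun_apply (\<sigma> (a ^ n)))"
    and close: "\<And>n s. 1 \<le> n \<Longrightarrow> n \<le> n0 \<Longrightarrow> s \<in> T \<Longrightarrow> norm (s - x n s) \<le> \<epsilon>"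
    and growth: "\<And>n s. n \<ge> 1 \<Longrightarrow> s \<in> T \<Longrightarrow> norm (x n s) \<le> \<alpha> n ^ n * max (norm s) \<delta>"
    and additive: "\<And>n s1 s2. n \<ge> 1 \<Longrightarrow> s1 \<in> T \<Longrightarrow> s2 \<in> T \<Longrightarrow> s1 + s2 \<in> T \<Longrightarrow>
      x n (s1 + s2) = x n s1 + x n s2"
    and homogeneous: "\<And>n \<mu> s. n \<ge> 1 \<Longrightarrow> s \<in> T \<Longrightarrow> sy \<mu> s \<in> T \<Longrightarrow> x n (sy \<mu> s) = sy \<mu> (x n s)"
    and construction:
      "\<exists>u b_inv idx.
        ((\<lambda>i. (r * (1 - r) ^ i) *\<^sub>R u (Suc i)) sums a) \<and>
        a \<in> closure (convex hull (u ` {1..})) \<and>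
        (\<forall>k. convex_partial_sum r u k \<in> convex hull (insert 1 (u ` {1..k})) \<and>
             convex_partial_sum r u k * b_inv k = 1 \<and> b_inv k * convex_partial_sum r u k = 1 \<and>
             b_inv k \<in> unital_closed_subalgebra_generated sb (u ` {1..k})) \<and>
        (\<forall>n\<ge>1. \<forall>s\<in>T. (\<lambda>k. blinfun_apply (\<sigma> (b_inv k ^ n)) s) \<longlonglongrightarrow> x n s) \<and>
        (\<forall>k\<ge>1. u k = e (idx k)) \<and>
        (\<forall>k\<ge>1. idx k \<le> idx (Suc k)) \<and>
        ((\<nexists>m::'i. \<forall>i. i \<le> m) \<longrightarrow> (\<forall>k\<ge>1. idx k < idx (Suc k)))"
    and bounded_image: "\<And>n. n \<ge> 1 \<Longrightarrow> bounded T \<Longrightarrow> bounded (x n ` T)"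
    and totally_bounded_image: "\<And>n. n \<ge> 1 \<Longrightarrow> totally_bounded T \<Longrightarrow> totally_bounded (x n ` T)"
    and approximation: "\<And>n. n \<ge> 1 \<Longrightarrow>
      uniform_limit T (\<lambda>i s. blinfun_apply (\<sigma> (e i)) (x n s)) (x n) net_filter"

end

theory Submission
  imports Defs
begin

text \<open>
  Uniform convergence on \<open>S\<close> passes to \<open>S'\<close> because the norm of \<open>X'\<close> is a supremum over \<open>\<Omega>\<close>, so it
  suffices to factorize a set \<open>T\<close> on which \<open>\<sigma>(e\<^sub>\<lambda>) s \<rightarrow> s\<close> uniformly. As in Cohen's factorization
  theorem, \<open>u\<^sub>1, u\<^sub>2, \<dots>\<close> are chosen successively so far out in the net that
  \<open>b\<^sub>k\<^sub>+\<^sub>1 = b\<^sub>k + r (1 - r)\<^sup>k (u\<^sub>k\<^sub>+\<^sub>1 - 1)\<close> stays invertible and its inverse \<open>c\<^sub>k\<^sub>+\<^sub>1\<close> grows at most by a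
  fixed factor. From \<open>c\<^sub>k\<^sub>+\<^sub>1 - c\<^sub>k = - r (1 - r)\<^sup>k c\<^sub>k\<^sub>+\<^sub>1 (u\<^sub>k\<^sub>+\<^sub>1 - 1) c\<^sub>k\<close> one sees that finitely many powers
  of \<open>c\<^sub>k\<close>, applied to \<open>T\<close>, change as little as desired. Letting the set of controlled powers
  grow slowly with \<open>k\<close>, at a pace dictated by \<open>\<alpha>\<close>, makes every sequence \<open>\<sigma>(c\<^sub>k\<^sup>n) s\<close> converge
  uniformly on \<open>T\<close> with the required bound on the limit.
\<close>

subsection \<open>Adjoining a unit and inverting perturbations of the unit\<close>

text \<open>Inverses are located in this real span of the unit and \<open>N\<close> for many
  \<open>N\<close> simultaneously: with \<open>N = commuting_part\<close> this yields uniform limits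
  on \<open>T\<close>, and with \<open>N\<close> a closed subalgebra containing the unit and the
  chosen elements it yields membership in the generated subalgebra.\<close>

definition adjoin_one :: "'b::real_algebra_1 set \<Rightarrow> 'b set"
  where "adjoin_one N = {t *\<^sub>R 1 + d | t d. d \<in> N}"

lemma closed_subalgebra_scaleR_iff:
  "closed_subalgebra scaleR N \<longleftrightarrow> closed N \<and> subspace N \<and> (\<forall>x\<in>N. \<forall>y\<in>N. x * y \<in> N)"
  unfolding closed_subalgebra_def subspace_raw_def ..

lemma closed_subalgebraD:
  assumes "closed_subalgebra scaleR N"
  shows "closed N" "subspace N" "\<And>x y. x \<in> N \<Longrightarrow> y \<in> N \<Longrightarrow> x * y \<in> N"
  using assms unfolding closed_subalgebra_scaleR_iff by auto

text \<open>Real scalars act through \<open>of_real\<close>, so the membership arguments below can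
  be carried out over the reals whatever the field is.\<close>

lemma closed_subalgebra_real:
  assumes "normed_algebra_over sb" "closed_subalgebra sb N"
  shows "closed_subalgebra scaleR N"
proof -
  interpret normed_algebra_over sb by fact
  have "subspace N"
    using assms(2) unfolding closed_subalgebra_def subspace_def
    by simp
  then have "real_vector.subspace N"
    unfolding subspace_def real_vector.subspace_def by (simp flip: scale_of_real)
  then show ?thesis
    using assms(2) unfolding closed_subalgebra_scaleR_iff unfolding closed_subalgebra_def by simp
qed

lemma adjoin_oneI: "d \<in> N \<Longrightarrow> t *\<^sub>R 1 + d \<in> adjoin_one N"
  unfolding adjoin_one_def by blast

lemma one_in_adjoin_one: "subspace N \<Longrightarrow> 1 \<in> adjoin_one N"
  using adjoin_oneI[of 0 N 1] by (simp add: subspace_0)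

lemma adjoin_one_scaleR:
  assumes "subspace N" "x \<in> adjoin_one N"
  shows "c *\<^sub>R x \<in> adjoin_one N"
proof -
  obtain t d where "x = t *\<^sub>R 1 + d" "d \<in> N" using assms(2) unfolding adjoin_one_def by blast
  then show ?thesis
    using adjoin_oneI[of "c *\<^sub>R d" N "c * t"] assms(1)
    by (simp add: subspace_scale scaleR_add_right)
qed

text \<open>A factor from \<open>N\<close> on the right removes the unit component. This keeps the
  correction terms of the Neumann series in \<open>N\<close> itself.\<close>

lemma adjoin_one_mult_right:
  assumes "closed_subalgebra scaleR N" "x \<in> adjoin_one N" "y \<in> N"
  shows "x * y \<in> N"
proof -
  note N = closed_subalgebraD[OF assms(1)]
  obtain t d where x: "x = t *\<^sub>R 1 + d" "d \<in> N" using assms(2) unfolding adjoin_one_def by blast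
  have "x * y = t *\<^sub>R y + d * y" by (simp add: x algebra_simps)
  then show ?thesis using N x assms(3) by (simp add: subspace_add subspace_scale)
qed

lemma adjoin_one_mult:
  assumes "closed_subalgebra scaleR N" "x \<in> adjoin_one N" "y \<in> adjoin_one N"
  shows "x * y \<in> adjoin_one N"
proof -
  note N = closed_subalgebraD[OF assms(1)]
  obtain t d where x: "x = t *\<^sub>R 1 + d" "d \<in> N" using assms(2) unfolding adjoin_one_def by blast
  obtain t' d' where y: "y = t' *\<^sub>R 1 + d'" "d' \<in> N" using assms(3) unfolding adjoin_one_def by blast
  have "x * y = (t * t') *\<^sub>R 1 + (t' *\<^sub>R d + x * d')" by (simp add: x y algebra_simps)
  moreover have "t' *\<^sub>R d + x * d' \<in> N"
    using N x y adjoin_one_mult_right[OF assms(1,2)] by (simp add: subspace_add subspace_scale)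
  ultimately show ?thesis by (simp add: adjoin_oneI)
qed

lemma adjoin_one_power:
  assumes "closed_subalgebra scaleR N" "x \<in> adjoin_one N"
  shows "x ^ n \<in> adjoin_one N"
  using assms
  by (induction n) (auto intro: adjoin_one_mult one_in_adjoin_one closed_subalgebraD)

lemma adjoin_one_absorb:
  assumes "subspace N" "1 \<in> N"
  shows "adjoin_one N \<subseteq> N"
  unfolding adjoin_one_def using assms by (auto intro!: subspace_add subspace_scale)

text \<open>The Neumann series splits into its leading term 1 and a tail of positive powers of
  \<open>y\<close>; the tail is a limit of elements of the closed set \<open>N\<close>. The set
  \<open>N\<close> is quantified after \<open>w\<close>, so a single inverse serves all
  \<open>N\<close>.\<close>

lemma neumann_inverse:
  fixes y :: "'b::{real_normed_algebra_1, banach}"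
  assumes "norm y < 1"
  obtains w where "(1 - y) * w = 1" "w * (1 - y) = 1" "norm w \<le> 1 / (1 - norm y)"
    "\<And>N. closed_subalgebra scaleR N \<Longrightarrow> y \<in> N \<Longrightarrow> w \<in> adjoin_one N"
proof -
  define w where "w = (\<Sum>n. y ^ n)"
  have sy: "summable (\<lambda>n. y ^ n)" by (rule complete_algebra_summable_geometric[OF assms])
  have w: "w = 1 + (\<Sum>n. y ^ Suc n)"
    using suminf_split_head[OF sy] by (simp add: w_def)
  have yw: "y * w = (\<Sum>n. y ^ Suc n)" using suminf_mult[OF sy, of y] by (simp add: w_def)
  have wy: "w * y = (\<Sum>n. y ^ Suc n)"
    using suminf_mult2[OF sy, of y] by (simp add: w_def power_commutes)
  have inv: "(1 - y) * w = 1" "w * (1 - y) = 1"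
    unfolding left_diff_distrib right_diff_distrib yw wy by (simp_all add: w)
  have "norm w \<le> (\<Sum>n. norm y ^ n)"
    unfolding w_def using assms by (intro norm_suminf_le) (auto simp: norm_power_ineq intro: summable_geometric)
  moreover have "w \<in> adjoin_one N" if N: "closed_subalgebra scaleR N" and y: "y \<in> N" for N
  proof -
    note N' = closed_subalgebraD[OF N]
    have pow: "y ^ Suc n \<in> N" for n
      using y N'(3) by (induction n) auto
    have "(\<lambda>m. \<Sum>n<m. y ^ Suc n) \<longlonglongrightarrow> (\<Sum>n. y ^ Suc n)"
      using sy by (intro summable_LIMSEQ) (subst summable_Suc_iff)
    moreover have "(\<Sum>n<m. y ^ Suc n) \<in> N" for m
      using pow N'(2) by (intro subspace_sum) auto
    ultimately have "(\<Sum>n. y ^ Suc n) \<in> N"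
      using closed_sequentially[OF N'(1), of "\<lambda>m. \<Sum>n<m. y ^ Suc n"] by simp
    then show ?thesis using adjoin_oneI[of _ N 1] w by simp
  qed
  ultimately show ?thesis
    using that[of w] assms inv by (simp add: suminf_geometric)
qed

text \<open>
  With \<open>F = (1 - r) + r u\<close>, which is close enough to \<open>1\<close> to be invertible, the perturbed element is
  \<open>t F + D = F (t + F\<inverse> D)\<close>, and \<open>F\<inverse> D\<close> is close to \<open>D\<close> as soon as \<open>u D\<close> is.
\<close>

lemma perturbed_inverse:
  fixes b c u D :: "'b::{real_normed_algebra_1, banach}"
  assumes r: "0 < r" "r < 1" and pos: "0 < 1 - r - r * M" and u: "norm u \<le> M"
    and b: "b = t *\<^sub>R 1 + D" "b * c = 1" "c * b = 1"
    and small: "norm c * (r * norm (D - u * D)) \<le> (1 - r - r * M) / 2"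
  obtains c' where "(b + (r * t) *\<^sub>R (u - 1)) * c' = 1" "c' * (b + (r * t) *\<^sub>R (u - 1)) = 1"
    "norm c' \<le> 2 / (1 - r - r * M) * norm c"
    "\<And>N. closed_subalgebra scaleR N \<Longrightarrow> u \<in> N \<Longrightarrow> D \<in> N \<Longrightarrow> c \<in> adjoin_one N \<Longrightarrow> c' \<in> adjoin_one N"
proof -
  \<comment> \<open>\<open>q\<close> is positive exactly when \<open>r < 1 / (M + 1)\<close>.
    Writing \<open>F = (1 - r) (1 - v)\<close> with \<open>v\<close> of norm at most
    \<open>r M / (1 - r) < 1\<close> bounds its inverse \<open>F'\<close> by
    \<open>1 / q\<close>.\<close>
  define q where "q = 1 - r - r * M"
  define v where "v = - (r / (1 - r)) *\<^sub>R u"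
  have nv: "norm v \<le> r / (1 - r) * M"
    using u r by (simp add: v_def mult_left_mono divide_right_mono)
  moreover have lt1: "r / (1 - r) * M < 1" using r pos by (simp add: field_simps)
  ultimately have "norm v < 1" by linarith
  from neumann_inverse[OF this] obtain w where
    w: "(1 - v) * w = 1" "w * (1 - v) = 1" "norm w \<le> 1 / (1 - norm v)"
    and wN: "\<And>N. closed_subalgebra scaleR N \<Longrightarrow> v \<in> N \<Longrightarrow> w \<in> adjoin_one N" by blast
  define F where "F = (1 - r) *\<^sub>R 1 + r *\<^sub>R u"
  define F' where "F' = (1 / (1 - r)) *\<^sub>R w"
  have F: "F = (1 - r) *\<^sub>R (1 - v)" using r by (simp add: F_def v_def scaleR_add_right)
  have FF': "F * F' = 1" "F' * F = 1" using r w by (simp_all add: F F'_def)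
  have nF': "norm F' \<le> 1 / q"
  proof -
    have "norm w \<le> 1 / (1 - r / (1 - r) * M)"
      using w(3) nv lt1 by (smt (verit) frac_le)
    then have "1 / (1 - r) * norm w \<le> 1 / (1 - r) * (1 / (1 - r / (1 - r) * M))"
      using r by (intro mult_left_mono) auto
    moreover have "norm F' = 1 / (1 - r) * norm w" using r by (simp add: F'_def)
    ultimately have "norm F' \<le> 1 / (1 - r) * (1 / (1 - r / (1 - r) * M))" by simp
    also have "\<dots> = 1 / q" using r pos lt1 by (simp add: q_def field_simps)
    finally show ?thesis .
  qed
  \<comment> \<open>Since \<open>F D = D - r z\<close>, the perturbed element equals
    \<open>F b + r z\<close>. The next line picks \<open>y\<close> so that this becomes
    \<open>F b (1 - y)\<close>.\<close>
  define z where "z = D - u * D"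
  define y where "y = - (r *\<^sub>R (c * F' * z))"
  have "norm (c * F' * z) \<le> norm c * (1 / q) * norm z"
    by (intro order_trans[OF norm_mult_ineq] mult_mono nF' order_refl) (use pos in \<open>auto simp: q_def\<close>)
  then have "r * norm (c * F' * z) \<le> r * (norm c * (1 / q) * norm z)"
    using r by (intro mult_left_mono) auto
  moreover have "norm y = r * norm (c * F' * z)" using r by (simp add: y_def)
  ultimately have "norm y \<le> r * (norm c * (1 / q) * norm z)" by simp
  also have "\<dots> = (norm c * (r * norm z)) / q" by simp
  also have "\<dots> \<le> (q / 2) / q"
    using small pos unfolding q_def z_def by (intro divide_right_mono) auto
  also have "\<dots> = 1 / 2" using pos by (simp add: q_def)
  \<comment> \<open>The bound 1/2 gives \<open>norm w' \<le> 2\<close>; together with the bound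
    \<open>1 / q\<close> for \<open>F'\<close> this is the origin of the growth factor
    \<open>2 / q\<close>.\<close>
  finally have ny: "norm y \<le> 1 / 2" .
  then have "norm y < 1" by simp
  from neumann_inverse[OF this] obtain w' where
    w': "(1 - y) * w' = 1" "w' * (1 - y) = 1" "norm w' \<le> 1 / (1 - norm y)"
    and w'N: "\<And>N. closed_subalgebra scaleR N \<Longrightarrow> y \<in> N \<Longrightarrow> w' \<in> adjoin_one N" by blast
  have "1 / (1 - norm y) \<le> 1 / (1 - 1 / 2)"
    using ny by (intro divide_left_mono) auto
  with w'(3) have nw': "norm w' \<le> 2" by simp
  define c' where "c' = w' * c * F'"
  have eq: "b + (r * t) *\<^sub>R (u - 1) = F * (b * (1 - y))"
  proof -
    have "b * (1 - y) = b + r *\<^sub>R (b * c * F' * z)" by (simp add: y_def algebra_simps)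
    then have "F * (b * (1 - y)) = F * b + r *\<^sub>R (F * F' * z)"
      by (simp add: b(2) distrib_left mult.assoc)
    then have "F * (b * (1 - y)) = F * b + r *\<^sub>R z" by (simp only: FF' mult_1_left)
    moreover have "F * b + r *\<^sub>R z = b + (r * t) *\<^sub>R (u - 1)"
      by (simp add: z_def F_def b(1) algebra_simps)
    ultimately show ?thesis by simp
  qed
  have bc: "b * (c * x) = x" "c * (b * x) = x" for x
    using b by (simp_all flip: mult.assoc)
  have FFx: "F * (F' * x) = x" "F' * (F * x) = x" for x
    using FF' by (simp_all flip: mult.assoc)
  have yw: "(1 - y) * (w' * x) = x" for x
    using w' by (simp flip: mult.assoc)
  have "(b + (r * t) *\<^sub>R (u - 1)) * c' = 1"
    unfolding eq c'_def by (simp add: mult.assoc yw bc FF')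
  moreover have "c' * (b + (r * t) *\<^sub>R (u - 1)) = 1"
    unfolding eq c'_def by (simp add: mult.assoc FFx bc w')
  moreover have "norm c' \<le> 2 / q * norm c"
  proof -
    have "norm c' \<le> 2 * norm c * (1 / q)"
      unfolding c'_def
      by (intro order_trans[OF norm_mult_ineq] mult_mono nF' nw' order_refl) auto
    then show ?thesis by simp
  qed
  moreover have "c' \<in> adjoin_one N"
    if N: "closed_subalgebra scaleR N" and uN: "u \<in> N" and DN: "D \<in> N" and cN: "c \<in> adjoin_one N" for N
  proof -
    note N' = closed_subalgebraD[OF N]
    have "v \<in> N" unfolding v_def using N'(2) uN by (rule subspace_scale)
    then have "F' \<in> adjoin_one N" unfolding F'_def using wN N N'(2) adjoin_one_scaleR by blast
    moreover have "z \<in> N" unfolding z_def using N'(2,3) uN DN by (simp add: subspace_diff)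
    ultimately have "c * F' * z \<in> N" using N cN adjoin_one_mult adjoin_one_mult_right by blast
    then have "y \<in> N" unfolding y_def using N'(2) by (simp add: subspace_neg subspace_scale)
    then show ?thesis
      unfolding c'_def using w'N N cN \<open>F' \<in> adjoin_one N\<close> adjoin_one_mult by blast
  qed
  ultimately show ?thesis using that[of c'] unfolding q_def by blast
qed

section \<open>Convex weights, geometric convergence and uniform approximation\<close>

text \<open>By induction with \<open>z\<close> varying: the last point is merged into
  \<open>z\<close>, which is replaced by \<open>(1 - r) z + r u (Suc k)\<close>. Later
  \<open>z\<close> is the unit, or the point \<open>u 1\<close> when the unit has to stay out of the
  hull.\<close>

lemma convex_weighted_sum_mem:
  fixes z :: "'b::real_vector"
  assumes "convex H" "0 \<le> r" "r \<le> 1" "z \<in> H" "\<And>i. 1 \<le> i \<Longrightarrow> i \<le> k \<Longrightarrow> u i \<in> H"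
  shows "(1 - r) ^ k *\<^sub>R z + (\<Sum>i=1..k. (r * (1 - r) ^ (i - 1)) *\<^sub>R u i) \<in> H"
  using assms(4,5)
proof (induction k arbitrary: z)
  case (Suc k)
  have "(1 - r) *\<^sub>R z + r *\<^sub>R u (Suc k) \<in> H"
    using Suc.prems assms(1-3) by (intro convexD) auto
  from Suc.IH[OF this] Suc.prems
  have "(1 - r) ^ k *\<^sub>R ((1 - r) *\<^sub>R z + r *\<^sub>R u (Suc k))
      + (\<Sum>i=1..k. (r * (1 - r) ^ (i - 1)) *\<^sub>R u i) \<in> H" by simp
  then show ?case by (simp add: scaleR_add_right mult.commute add_ac)
qed simp

lemma geometric_increments_converge:
  fixes f :: "nat \<Rightarrow> 'a::banach"
  assumes "\<And>j. j \<ge> k \<Longrightarrow> norm (f (Suc j) - f j) \<le> \<eta> / 2 ^ Suc j"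
  shows "convergent f" and "\<And>j. j \<ge> k \<Longrightarrow> norm (lim f - f j) \<le> \<eta> / 2 ^ j"
proof -
  \<comment> \<open>Subtracting the remaining geometric tail makes the induction on \<open>m\<close>
    close exactly.\<close>
  have *: "norm (f (j + m) - f j) \<le> \<eta> / 2 ^ j - \<eta> / 2 ^ (j + m)" if "j \<ge> k" for j m
  proof (induction m)
    case (Suc m)
    have "norm (f (j + Suc m) - f j) \<le> norm (f (Suc (j + m)) - f (j + m)) + norm (f (j + m) - f j)"
      using norm_triangle_ineq[of "f (Suc (j + m)) - f (j + m)" "f (j + m) - f j"] by simp
    also have "\<dots> \<le> \<eta> / 2 ^ Suc (j + m) + (\<eta> / 2 ^ j - \<eta> / 2 ^ (j + m))"
      using assms[of "j + m"] that Suc.IH by (intro add_mono) auto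
    finally show ?case by (simp add: field_simps)
  qed simp
  have "0 \<le> \<eta> / 2 ^ Suc k" using assms[of k] norm_ge_zero order_trans by blast
  then have "0 \<le> \<eta> / 2 ^ Suc k * 2 ^ Suc k" by (intro mult_nonneg_nonneg) auto
  then have \<eta>: "0 \<le> \<eta>" by simp
  have bd: "norm (f i - f j) \<le> \<eta> / 2 ^ j" if "j \<ge> k" "i \<ge> j" for i j
  proof -
    have "norm (f (j + (i - j)) - f j) \<le> \<eta> / 2 ^ j - \<eta> / 2 ^ (j + (i - j))" using * that by blast
    also have "\<dots> \<le> \<eta> / 2 ^ j" using \<eta> by simp
    finally show ?thesis using that by simp
  qed
  have lim0: "(\<lambda>j. \<eta> / 2 ^ j) \<longlonglongrightarrow> 0"
    using tendsto_mult_right_zero[OF LIMSEQ_inverse_realpow_zero[of 2], of \<eta>] by (simp add: divide_inverse)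
  have "Cauchy f"
  proof (rule CauchyI')
    fix e :: real assume "0 < e"
    then have "\<forall>\<^sub>F j in sequentially. \<eta> / 2 ^ j < e" by (rule order_tendstoD(2)[OF lim0])
    then obtain j0 where j0: "\<And>j. j \<ge> j0 \<Longrightarrow> \<eta> / 2 ^ j < e" unfolding eventually_sequentially by blast
    show "\<exists>M. \<forall>m\<ge>M. \<forall>n>m. dist (f m) (f n) < e"
    proof (intro exI[of _ "max j0 k"] allI impI)
      fix m n :: nat assume "max j0 k \<le> m" "m < n"
      then show "dist (f m) (f n) < e"
        using bd[of m n] j0[of m] by (simp add: dist_norm norm_minus_commute)
    qed
  qed
  then show conv: "convergent f" by (simp add: Cauchy_convergent_iff)
  fix j assume j: "j \<ge> k"
  have "(\<lambda>i. norm (f i - f j)) \<longlonglongrightarrow> norm (lim f - f j)"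
    using conv by (intro tendsto_intros) (simp add: convergent_LIMSEQ_iff)
  then show "norm (lim f - f j) \<le> \<eta> / 2 ^ j"
    by (rule LIMSEQ_le_const2) (use bd j in auto)
qed

text \<open>Applied to the maps \<open>x n\<close>, which are uniform limits on \<open>T\<close> of
  bounded linear operators even when \<open>T\<close> is unbounded. Each approximant is uniformly
  continuous, so a three-term estimate suffices.\<close>

lemma uniformly_continuous_on_approx:
  assumes "\<And>\<epsilon>. \<epsilon> > 0 \<Longrightarrow> \<exists>g. bounded_linear g \<and> (\<forall>s\<in>T. norm (f s - g s) < \<epsilon>)"
  shows "uniformly_continuous_on T f"
  unfolding uniformly_continuous_on_def
proof (intro allI impI)
  fix \<epsilon> :: real assume \<epsilon>: "\<epsilon> > 0"
  then obtain g where g: "bounded_linear g" "\<And>s. s \<in> T \<Longrightarrow> norm (f s - g s) < \<epsilon> / 3"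
    using assms[of "\<epsilon> / 3"] by auto
  have "uniformly_continuous_on UNIV g"
    using bounded_linear.uniformly_continuous_on[OF g(1) uniformly_continuous_on_id] .
  then obtain d where d: "d > 0" "\<And>x y. dist y x < d \<Longrightarrow> dist (g y) (g x) < \<epsilon> / 3"
    unfolding uniformly_continuous_on_def using \<epsilon> by (metis UNIV_I divide_pos_pos zero_less_numeral)
  have "dist (f y) (f x) < \<epsilon>" if "x \<in> T" "y \<in> T" "dist y x < d" for x y
  proof -
    have "f y - f x = (f y - g y) + (g y - g x) - (f x - g x)" by simp
    then have "norm (f y - f x) \<le> norm (f y - g y) + norm (g y - g x) + norm (f x - g x)"
      by (metis norm_triangle_le_diff norm_triangle_ineq add_mono order_refl)
    then show ?thesis using g(2)[OF that(1)] g(2)[OF that(2)] d(2)[OF that(3)]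
      by (simp add: dist_norm)
  qed
  then show "\<exists>d>0. \<forall>x\<in>T. \<forall>x'\<in>T. dist x' x < d \<longrightarrow> dist (f x') (f x) < \<epsilon>" using d(1) by blast
qed

text \<open>A finite net of \<open>T\<close> may have centres outside \<open>T\<close>, where
  \<open>f\<close> is not controlled; the centres of the new net are therefore their images under
  the globally defined \<open>g\<close>.\<close>

lemma totally_bounded_image_approx:
  assumes "\<And>\<epsilon>. \<epsilon> > 0 \<Longrightarrow> \<exists>g. bounded_linear g \<and> (\<forall>s\<in>T. norm (f s - g s) < \<epsilon>)"
    and T: "totally_bounded T"
  shows "totally_bounded (f ` T)"
  unfolding totally_bounded_metric
proof (intro allI impI)
  fix \<epsilon> :: real assume \<epsilon>: "\<epsilon> > 0"
  then obtain g where g: "bounded_linear g" "\<And>s. s \<in> T \<Longrightarrow> norm (f s - g s) < \<epsilon> / 2"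
    using assms(1)[of "\<epsilon> / 2"] by auto
  have "uniformly_continuous_on UNIV g"
    using bounded_linear.uniformly_continuous_on[OF g(1) uniformly_continuous_on_id] .
  then obtain d where d: "d > 0" "\<And>x y. dist y x < d \<Longrightarrow> dist (g y) (g x) < \<epsilon> / 2"
    unfolding uniformly_continuous_on_def using \<epsilon> by (metis UNIV_I half_gt_zero)
  obtain F where F: "finite F" "T \<subseteq> (\<Union>x\<in>F. {y. dist x y < d})"
    using T d(1) unfolding totally_bounded_metric by blast
  have "f s \<in> (\<Union>x\<in>g ` F. {y. dist x y < \<epsilon>})" if s: "s \<in> T" for s
  proof -
    obtain y where y: "y \<in> F" "dist y s < d" using F(2) s by blast
    have "dist (g y) (f s) \<le> dist (g y) (g s) + dist (g s) (f s)" by (rule dist_triangle)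
    also have "\<dots> < \<epsilon>"
      using d(2)[OF y(2)] g(2)[OF s] by (simp add: dist_norm norm_minus_commute)
    finally show ?thesis using y(1) by blast
  qed
  then show "\<exists>k. finite k \<and> f ` T \<subseteq> (\<Union>x\<in>k. {y. dist x y < \<epsilon>})"
    using F(1) by (intro exI[of _ "g ` F"]) auto
qed

text \<open>The term \<open>(1 - r) ^ k z\<close> vanishes in the limit, so the limit does not
  depend on \<open>z\<close>: \<open>z = 1\<close> shows that the \<open>b_k\<close> tend to
  \<open>a\<close>, and \<open>z = u 1\<close> puts \<open>a\<close> into the closed convex hull of
  the \<open>u i\<close> alone.\<close>

lemma sums_convex_weights:
  fixes u :: "nat \<Rightarrow> 'b::banach"
  assumes r: "0 < r" "r < 1" and u: "\<And>i. norm (u i) \<le> M"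
  obtains a where "(\<lambda>i. (r * (1 - r) ^ i) *\<^sub>R u (Suc i)) sums a"
    "\<And>z. (\<lambda>k. (1 - r) ^ k *\<^sub>R z + (\<Sum>i=1..k. (r * (1 - r) ^ (i - 1)) *\<^sub>R u i)) \<longlonglongrightarrow> a"
    "a \<in> closure (convex hull (u ` {1..}))"
proof -
  have "summable (\<lambda>i. (r * (1 - r) ^ i) *\<^sub>R u (Suc i))"
  proof (rule summable_comparison_test)
    show "summable (\<lambda>i. M * r * (1 - r) ^ i)"
      using r by (intro summable_mult) simp
    have "norm ((r * (1 - r) ^ i) *\<^sub>R u (Suc i)) \<le> M * r * (1 - r) ^ i" for i
      using mult_left_mono[OF u[of "Suc i"], of "r * (1 - r) ^ i"] r by (simp add: ac_simps abs_mult)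
    then show "\<exists>N. \<forall>i\<ge>N. norm ((r * (1 - r) ^ i) *\<^sub>R u (Suc i)) \<le> M * r * (1 - r) ^ i" by blast
  qed
  then obtain a where a: "(\<lambda>i. (r * (1 - r) ^ i) *\<^sub>R u (Suc i)) sums a" unfolding summable_def by blast
  have lim: "(\<lambda>k. (1 - r) ^ k *\<^sub>R z + (\<Sum>i=1..k. (r * (1 - r) ^ (i - 1)) *\<^sub>R u i)) \<longlonglongrightarrow> a" for z
  proof -
    have pow: "(\<lambda>k. (1 - r) ^ k) \<longlonglongrightarrow> 0" using r by (intro LIMSEQ_realpow_zero) auto
    have "(\<lambda>k. (1 - r) ^ k *\<^sub>R z + (\<Sum>i<k. (r * (1 - r) ^ i) *\<^sub>R u (Suc i))) \<longlonglongrightarrow> 0 *\<^sub>R z + a"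
      by (intro tendsto_add[OF tendsto_scaleR[OF pow tendsto_const]] a[unfolded sums_def])
    then show ?thesis by (simp add: sum.atLeast1_atMost_eq)
  qed
  have "(1 - r) ^ k *\<^sub>R u 1 + (\<Sum>i=1..k. (r * (1 - r) ^ (i - 1)) *\<^sub>R u i) \<in> convex hull (u ` {1..})" for k
    using r by (intro convex_weighted_sum_mem) (auto intro: hull_inc)
  then have "a \<in> closure (convex hull (u ` {1..}))"
    by (intro closed_sequentially[OF closed_closure _ lim[of "u 1"]] allI subsetD[OF closure_subset])
  with a lim show ?thesis using that by blast
qed

subsection \<open>Uniformly approximated sets\<close>

text \<open>One representation on one Banach space: the space of bounded maps is abstracted away and
  returns only when the locale is interpreted with \<open>T = S'\<close>.\<close>

locale uniformly_approximated_set =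
  fixes sb :: "'k::real_normed_field \<Rightarrow> 'b::{real_normed_algebra_1, banach} \<Rightarrow> 'b"
    and sy :: "'k \<Rightarrow> 'y::banach \<Rightarrow> 'y"
    and A :: "'b set"
    and e :: "'i::preorder \<Rightarrow> 'b"
    and M :: real
    and \<sigma> :: "'b \<Rightarrow> 'y \<Rightarrow>\<^sub>L 'y"
    and T :: "'y set"
  assumes algebra: "normed_algebra_over sb"
    and space: "normed_space_over sy"
    and subalgebra: "closed_subalgebra sb A"
    and M_ge_1: "1 \<le> M"
    and approximate_identity: "bounded_left_approximate_identity A e M"
    and representation: "continuous_unital_representation sb sy \<sigma>"
    and uniform_on_T: "uniform_limit T (\<lambda>i s. blinfun_apply (\<sigma> (e i)) s) (\<lambda>s. s) net_filter"
    and bounded_or_commutative: "bounded T \<or> (\<forall>i j. e i * e j = e j * e i)"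
begin

lemma directed: "directed_index TYPE('i)"
  and e_mem: "e i \<in> A"
  and norm_e: "norm (e i) \<le> M"
  and tendsto_e_mult: "a \<in> A \<Longrightarrow> ((\<lambda>i. e i * a) \<longlongrightarrow> a) net_filter"
  using approximate_identity unfolding bounded_left_approximate_identity_def by auto

lemma \<sigma>_sy: "\<sigma> a (sy c v) = sy c (\<sigma> a v)"
  and \<sigma>_add: "\<sigma> (a + b) = \<sigma> a + \<sigma> b"
  and \<sigma>_mult: "\<sigma> (a * b) v = \<sigma> a (\<sigma> b v)"
  and \<sigma>_one: "\<sigma> 1 v = v"
  using representation
  unfolding continuous_unital_representation_def continuous_representation_def by auto

text \<open>Continuity at 0 gives a ball of radius \<open>d\<close> on which \<open>\<sigma>\<close>
  has norm below 1; rescaling to norm \<open>d / 2\<close> gives the constant \<open>2 / d\<close>.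
  From here on \<open>onorm \<sigma>\<close> can be used in estimates.\<close>

lemma bounded_linear_\<sigma>: "bounded_linear \<sigma>"
proof -
  have "\<sigma> (c *\<^sub>R a) v = c *\<^sub>R \<sigma> a v" for c a v
  proof -
    have "\<sigma> (sb (of_real c) a) v = sy (of_real c) (\<sigma> a v)"
      using representation
      unfolding continuous_unital_representation_def continuous_representation_def by auto
    then show ?thesis
      using algebra space
      by (simp add: normed_algebra_over_def normed_space_over.scale_of_real)
  qed
  then have scale: "\<sigma> (c *\<^sub>R a) = c *\<^sub>R \<sigma> a" for c a
    by (intro blinfun_eqI) (simp add: scaleR_blinfun.rep_eq)
  then interpret linear \<sigma>
    by (intro linearI \<sigma>_add)
  have "isCont \<sigma> 0"
    using representation
    unfolding continuous_unital_representation_def continuous_representation_def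
    by (simp add: continuous_on_eq_continuous_at)
  then obtain d where d: "d > 0" "\<And>b. norm b < d \<Longrightarrow> norm (\<sigma> b) < 1"
    unfolding continuous_at_eps_delta using zero_less_one
    by (auto simp: dist_norm zero dest: spec[of _ 1])
  have "norm (\<sigma> b) \<le> norm b * (2 / d)" for b
  proof (cases "b = 0")
    case False
    define t where "t = d / (2 * norm b)"
    have "t > 0" using False d by (simp add: t_def)
    have "norm (t *\<^sub>R b) < d" using False d by (simp add: t_def)
    then have "t * norm (\<sigma> b) < 1" using d(2) \<open>t > 0\<close> by (fastforce simp: scale)
    then have "norm (\<sigma> b) < 1 / t" using \<open>t > 0\<close> by (simp add: field_simps)
    then show ?thesis by (simp add: t_def mult.commute)
  qed (simp add: zero)
  then show ?thesis by unfold_locales blast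
qed

lemma \<sigma>_diff: "\<sigma> (a - b) v = \<sigma> a v - \<sigma> b v"
  and \<sigma>_scaleR: "\<sigma> (c *\<^sub>R a) v = c *\<^sub>R \<sigma> a v"
  using linear_diff[OF bounded_linear.linear[OF bounded_linear_\<sigma>]]
    linear_scale[OF bounded_linear.linear[OF bounded_linear_\<sigma>]]
  by (simp_all add: minus_blinfun.rep_eq scaleR_blinfun.rep_eq)

lemma \<sigma>_bound: "norm (\<sigma> b v) \<le> onorm \<sigma> * norm b * norm v"
  by (intro order_trans[OF norm_blinfun] mult_right_mono onorm bounded_linear_\<sigma>) auto

lemma onorm_\<sigma>_nonneg: "0 \<le> onorm \<sigma>"
  by (rule onorm_pos_le[OF bounded_linear_\<sigma>])

section \<open>Uniform limits along the approximate identity\<close>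

text \<open>The implication treats both cases of the hypothesis at once: this is the set of elements
  of \<open>A\<close> commuting with every \<open>e i\<close> if the \<open>e i\<close> commute
  pairwise, and all of \<open>A\<close> otherwise.\<close>

definition commuting_part :: "'b set"
  where "commuting_part = {g \<in> A. (\<forall>i j. e i * e j = e j * e i) \<longrightarrow> (\<forall>i. e i * g = g * e i)}"

lemma e_in_commuting_part: "e i \<in> commuting_part"
  unfolding commuting_part_def using e_mem by auto

lemma closed_subalgebra_commuting_part: "closed_subalgebra scaleR commuting_part"
proof -
  note A = closed_subalgebraD[OF closed_subalgebra_real[OF algebra subalgebra]]
  have "closed {g. P \<longrightarrow> (\<forall>i. e i * g = g * e i)}" for P
    by (cases P) (auto intro!: closed_Collect_all closed_Collect_eq continuous_intros)
  then have "closed commuting_part"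
    unfolding commuting_part_def Collect_conj_eq Collect_mem_eq using A(1) by (intro closed_Int)
  moreover have "subspace commuting_part"
    unfolding subspace_def commuting_part_def using A(2)
    by (auto simp: subspace_0 subspace_add subspace_scale algebra_simps)
  moreover have "x * y \<in> commuting_part" if "x \<in> commuting_part" "y \<in> commuting_part" for x y
    using that A(3) unfolding commuting_part_def by (auto, metis mult.assoc)
  ultimately show ?thesis unfolding closed_subalgebra_scaleR_iff by blast
qed

text \<open>
  This is the only place where the set has to be bounded or the approximate identity
  commutative.
\<close>

lemma uniform_limit_adjoin_one:
  assumes "g \<in> adjoin_one commuting_part"
  shows "uniform_limit T (\<lambda>i s. \<sigma> (e i * g) s) (\<lambda>s. \<sigma> g s) net_filter"
proof -
  obtain t d where g: "g = t *\<^sub>R 1 + d" and d: "d \<in> commuting_part"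
    using assms unfolding adjoin_one_def by blast
  show ?thesis
  proof (cases "\<forall>i j. e i * e j = e j * e i")
    case True
    \<comment> \<open>Commuting moves \<open>e i\<close> next to \<open>s\<close>, so the uniform
      convergence on \<open>T\<close> is just transported by the bounded operator
      \<open>\<sigma> g\<close>.\<close>
    then have "e i * g = g * e i" for i
      using d by (simp add: g commuting_part_def algebra_simps)
    then show ?thesis
      using bounded_linear.uniform_limit[OF blinfun.bounded_linear_right uniform_on_T, of "\<sigma> g"]
      by (simp add: \<sigma>_mult)
  next
    case False
    then obtain R where R: "R > 0" "\<And>s. s \<in> T \<Longrightarrow> norm s \<le> R"
      using bounded_or_commutative unfolding bounded_pos by blast
    \<comment> \<open>For bounded \<open>T\<close>, norm convergence of \<open>e i * d\<close> to
      \<open>d\<close> becomes uniform on \<open>T\<close>; the unit component \<open>t\<close> of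
      \<open>g\<close> is covered by the hypothesis on \<open>T\<close>.\<close>
    have "((\<lambda>i. \<sigma> (e i * d)) \<longlongrightarrow> \<sigma> d) net_filter"
      using d tendsto_e_mult by (intro bounded_linear.tendsto[OF bounded_linear_\<sigma>]) (auto simp: commuting_part_def)
    then have "uniform_limit T (\<lambda>i s. \<sigma> (e i * d) s) (\<lambda>s. \<sigma> d s) net_filter"
      unfolding uniform_limit_iff
    proof (intro allI impI)
      fix \<epsilon> :: real
      assume lim: "((\<lambda>i. \<sigma> (e i * d)) \<longlongrightarrow> \<sigma> d) net_filter" and "\<epsilon> > 0"
      then have "\<forall>\<^sub>F i in net_filter. dist (\<sigma> (e i * d)) (\<sigma> d) < \<epsilon> / R"
        using R(1) by (intro tendstoD) auto
      then show "\<forall>\<^sub>F i in net_filter. \<forall>s\<in>T. dist (\<sigma> (e i * d) s) (\<sigma> d s) < \<epsilon>"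
      proof (rule eventually_mono, intro ballI)
        fix i s assume i: "dist (\<sigma> (e i * d)) (\<sigma> d) < \<epsilon> / R" and s: "s \<in> T"
        have "dist (\<sigma> (e i * d) s) (\<sigma> d s) \<le> norm (\<sigma> (e i * d) - \<sigma> d) * norm s"
          using norm_blinfun[of "\<sigma> (e i * d) - \<sigma> d" s] by (simp add: dist_norm minus_blinfun.rep_eq)
        also have "\<dots> \<le> norm (\<sigma> (e i * d) - \<sigma> d) * R"
          using R(2)[OF s] by (intro mult_left_mono) auto
        also have "\<dots> < \<epsilon>" using i R(1) by (simp add: dist_norm field_simps)
        finally show "dist (\<sigma> (e i * d) s) (\<sigma> d s) < \<epsilon>" .
      qed
    qed
    from uniform_limit_add[OF bounded_linear.uniform_limit[OF bounded_linear_scaleR_right uniform_on_T, of t] this]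
    show ?thesis by (simp add: g \<sigma>_add \<sigma>_scaleR \<sigma>_one distrib_left plus_blinfun.rep_eq)
  qed
qed

text \<open>
  The difference of the inverses of \<open>b\<close> and \<open>b + \<tau> (e i - 1)\<close> is \<open>\<tau> c' (e i - 1) c\<close> up to sign, and
  \<open>e i - 1\<close> is small on the images of \<^term>\<open>T\<close> under powers of \<open>c\<close>.
\<close>

lemma uniform_limit_perturbed_inverse:
  assumes c: "c \<in> adjoin_one commuting_part" and bc: "b * c = 1"
    and c': "\<forall>\<^sub>F i in net_filter. c' i * (b + \<tau> *\<^sub>R (e i - 1)) = 1 \<and> norm (c' i) \<le> L"
  shows "uniform_limit T (\<lambda>i s. \<sigma> (c' i ^ n) s) (\<lambda>s. \<sigma> (c ^ n) s) net_filter"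
proof (induction n)
  case 0
  show ?case by (auto simp: \<sigma>_one uniform_limit_iff)
next
  case (Suc n)
  \<comment> \<open>\<open>K\<close> bounds the norms of the operators
    \<open>\<sigma> (c' i)\<close>. Here and in \<open>\<theta>\<close> the added 1 ensures a
    positive divisor.\<close>
  define K where "K = onorm \<sigma> * \<bar>L\<bar> + 1"
  have K: "K > 0" unfolding K_def using onorm_\<sigma>_nonneg by (simp add: add_nonneg_pos)
  define \<theta> where "\<theta> = \<bar>\<tau>\<bar> + 1"
  have \<theta>: "\<theta> > 0" "\<bar>\<tau>\<bar> \<le> \<theta>" by (simp_all add: \<theta>_def)
  define q where "q i s = \<sigma> (e i * c ^ Suc n) s - \<sigma> (c ^ Suc n) s" for i s
  define p where "p i s = \<sigma> (c' i ^ n) s - \<sigma> (c ^ n) s" for i s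
  have "c ^ Suc n \<in> adjoin_one commuting_part"
    using adjoin_one_power closed_subalgebra_commuting_part c by blast
  note lim = uniform_limit_adjoin_one[OF this]
  show ?case
    unfolding uniform_limit_iff
  proof (intro allI impI)
    fix \<epsilon> :: real assume \<epsilon>: "\<epsilon> > 0"
    have "\<forall>\<^sub>F i in net_filter. \<forall>s\<in>T. norm (p i s) < \<epsilon> / (2 * K)"
      using Suc.IH \<epsilon> K unfolding uniform_limit_iff p_def dist_norm by simp
    moreover have "\<forall>\<^sub>F i in net_filter. \<forall>s\<in>T. norm (q i s) < \<epsilon> / (2 * K * \<theta>)"
      using lim \<epsilon> K \<theta> unfolding uniform_limit_iff q_def dist_norm
      by (auto dest!: spec[of _ "\<epsilon> / (2 * K * \<theta>)"])
    ultimately show "\<forall>\<^sub>F i in net_filter. \<forall>s\<in>T. dist (\<sigma> (c' i ^ Suc n) s) (\<sigma> (c ^ Suc n) s) < \<epsilon>"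
      using c'
    proof eventually_elim
      case (elim i)
      show ?case
      proof
        fix s assume s: "s \<in> T"
        have inv: "c' i * (b + \<tau> *\<^sub>R (e i - 1)) = 1" and nc': "norm (c' i) \<le> L" using elim by auto
        have "c = c' i * (b * c + \<tau> *\<^sub>R (e i * c - c))"
          using arg_cong[OF inv, of "\<lambda>x. x * c"] by (simp add: algebra_simps)
        then have "c' i - c = - (\<tau> *\<^sub>R (c' i * (e i * c - c)))"
          by (simp add: bc algebra_simps)
        then have "(c' i - c) * c ^ n = - (\<tau> *\<^sub>R (c' i * (e i * c - c))) * c ^ n"
          by simp
        \<comment> \<open>The telescoping \<open>c' (c'^n - c^n) + (c' - c) c^n\<close>: the first
          part is controlled by the induction hypothesis through \<open>p\<close>, the second by the
          previous lemma through \<open>q\<close>.\<close>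
        then have "c' i ^ Suc n - c ^ Suc n
            = c' i * (c' i ^ n - c ^ n) - \<tau> *\<^sub>R (c' i * (e i * c ^ Suc n - c ^ Suc n))"
          by (simp add: algebra_simps)
        then have "\<sigma> (c' i ^ Suc n - c ^ Suc n) s = \<sigma> (c' i) (p i s - \<tau> *\<^sub>R q i s)"
          unfolding p_def q_def
          by (simp only: \<sigma>_mult \<sigma>_scaleR \<sigma>_diff blinfun.diff_right blinfun.scaleR_right)
        then have "dist (\<sigma> (c' i ^ Suc n) s) (\<sigma> (c ^ Suc n) s)
            \<le> onorm \<sigma> * norm (c' i) * norm (p i s - \<tau> *\<^sub>R q i s)"
          unfolding dist_norm using \<sigma>_bound by (simp only: \<sigma>_diff)
        also have "\<dots> \<le> K * norm (p i s - \<tau> *\<^sub>R q i s)"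
        proof (rule mult_right_mono)
          have "onorm \<sigma> * norm (c' i) \<le> onorm \<sigma> * \<bar>L\<bar>"
            using onorm_\<sigma>_nonneg nc' by (intro mult_left_mono) auto
          then show "onorm \<sigma> * norm (c' i) \<le> K" by (simp add: K_def)
        qed simp
        also have "\<dots> \<le> K * (norm (p i s) + \<bar>\<tau>\<bar> * norm (q i s))"
          using K by (intro mult_left_mono) (auto intro: order_trans[OF norm_triangle_ineq4])
        also have "\<dots> < K * (\<epsilon> / (2 * K) + \<epsilon> / (2 * K))"
        proof (intro mult_strict_left_mono add_less_le_mono K)
          show "norm (p i s) < \<epsilon> / (2 * K)" using elim s by blast
          have "\<bar>\<tau>\<bar> * norm (q i s) \<le> \<theta> * (\<epsilon> / (2 * K * \<theta>))"
            using elim s \<theta> by (intro mult_mono) (auto intro: less_imp_le)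
          also have "\<dots> = \<epsilon> / (2 * K)" using K \<theta> by (simp add: field_simps)
          finally show "\<bar>\<tau>\<bar> * norm (q i s) \<le> \<epsilon> / (2 * K)" .
        qed
        also have "\<dots> = \<epsilon>" using K by (simp add: field_simps)
        finally show "dist (\<sigma> (c' i ^ Suc n) s) (\<sigma> (c ^ Suc n) s) < \<epsilon>" .
      qed
    qed
  qed
qed

section \<open>Successive choice of the approximating elements and inverses\<close>

text \<open>All requirements hold eventually along the net: \<open>e j * D\<close> tends to
  \<open>D\<close>, which gives the inverse, and the finitely many powers in \<open>Q\<close>
  converge uniformly on \<open>T\<close>. Finiteness of \<open>Q\<close> allows a single
  \<open>j\<close> for all of them.\<close>

lemma extend_inverse:
  assumes r: "0 < r" "r < inverse (M + 1)"
    and b: "b = t *\<^sub>R 1 + D" "b * c = 1" "c * b = 1"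
    and D: "D \<in> commuting_part" and c: "c \<in> adjoin_one commuting_part"
    and Q: "finite Q" and \<eta>: "\<eta> > 0"
  shows "\<exists>j c'. i \<le> j \<and> ((\<nexists>m::'i. \<forall>i. i \<le> m) \<longrightarrow> i < j) \<and>
    (b + (r * t) *\<^sub>R (e j - 1)) * c' = 1 \<and> c' * (b + (r * t) *\<^sub>R (e j - 1)) = 1 \<and>
    norm c' \<le> 2 / (1 - r - r * M) * norm c \<and>
    (\<forall>N. closed_subalgebra scaleR N \<longrightarrow> e j \<in> N \<longrightarrow> D \<in> N \<longrightarrow> c \<in> adjoin_one N \<longrightarrow> c' \<in> adjoin_one N) \<and>
    (\<forall>n\<in>Q. \<forall>s\<in>T. norm (\<sigma> (c' ^ n) s - \<sigma> (c ^ n) s) \<le> \<eta>)"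
proof -
  define P where "P j c' \<longleftrightarrow> (b + (r * t) *\<^sub>R (e j - 1)) * c' = 1 \<and> c' * (b + (r * t) *\<^sub>R (e j - 1)) = 1 \<and>
    norm c' \<le> 2 / (1 - r - r * M) * norm c \<and>
    (\<forall>N. closed_subalgebra scaleR N \<longrightarrow> e j \<in> N \<longrightarrow> D \<in> N \<longrightarrow> c \<in> adjoin_one N \<longrightarrow> c' \<in> adjoin_one N)" for j c'
  have rM: "r * (M + 1) < 1" using r M_ge_1 by (simp add: field_simps)
  then have pos: "0 < 1 - r - r * M" by (simp add: distrib_left)
  have "r * 1 \<le> r * M" using r M_ge_1 by (intro mult_left_mono) auto
  then have r1: "r < 1" using pos r(1) by linarith
  have "((\<lambda>j. norm c * (r * norm (D - e j * D))) \<longlongrightarrow> norm c * (r * norm (D - D))) net_filter"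
    using D by (intro tendsto_intros tendsto_e_mult) (simp add: commuting_part_def)
  then have "\<forall>\<^sub>F j in net_filter. norm c * (r * norm (D - e j * D)) < (1 - r - r * M) / 2"
    using pos by (intro order_tendstoD(2)) auto
  then have "\<forall>\<^sub>F j in net_filter. \<exists>c'. P j c'"
  proof eventually_elim
    case (elim j)
    show ?case
      by (rule perturbed_inverse[OF r(1) r1 pos norm_e b less_imp_le[OF elim]])
         (unfold P_def, blast)
  qed
  then obtain c' where c': "\<forall>\<^sub>F j in net_filter. P j (c' j)"
    unfolding eventually_ex by blast
  then have "\<forall>\<^sub>F j in net_filter. c' j * (b + (r * t) *\<^sub>R (e j - 1)) = 1 \<and>
      norm (c' j) \<le> 2 / (1 - r - r * M) * norm c"
    by eventually_elim (simp add: P_def)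
  note lim = uniform_limit_perturbed_inverse[OF c b(2) this]
  have "\<forall>\<^sub>F j in net_filter. \<forall>n\<in>Q. \<forall>s\<in>T. norm (\<sigma> (c' j ^ n) s - \<sigma> (c ^ n) s) < \<eta>"
    using lim \<eta> unfolding uniform_limit_iff dist_norm by (intro eventually_ball_finite[OF Q]) blast
  from eventually_conj[OF c' this] obtain j0 where j0: "\<And>j. j0 \<le> j \<Longrightarrow> P j (c' j) \<and>
      (\<forall>n\<in>Q. \<forall>s\<in>T. norm (\<sigma> (c' j ^ n) s - \<sigma> (c ^ n) s) < \<eta>)"
    unfolding eventually_net_filter[OF directed] by blast
  \<comment> \<open>If there is no largest index, some \<open>i'\<close> is not below
    \<open>i\<close>. Any \<open>j\<close> above both \<open>i\<close> and \<open>i'\<close> then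
    satisfies \<open>i < j\<close>, since \<open>j \<le> i\<close> would give
    \<open>i' \<le> i\<close>.\<close>
  obtain i' where i': "(\<nexists>m::'i. \<forall>i. i \<le> m) \<Longrightarrow> \<not> i' \<le> i" by blast
  obtain j1 where j1: "j0 \<le> j1" "i \<le> j1" using directed unfolding directed_index_def by blast
  obtain j where j: "j1 \<le> j" "i' \<le> j" using directed unfolding directed_index_def by blast
  have "i \<le> j" "j0 \<le> j" using j j1 order_trans by blast+
  moreover have "(\<nexists>m::'i. \<forall>i. i \<le> m) \<longrightarrow> i < j"
    using i' j \<open>i \<le> j\<close> order_trans unfolding less_le_not_le by blast
  moreover have "P j (c' j)" "\<forall>n\<in>Q. \<forall>s\<in>T. norm (\<sigma> (c' j ^ n) s - \<sigma> (c ^ n) s) \<le> \<eta>"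
    using j0[OF \<open>j0 \<le> j\<close>] less_imp_le by blast+
  ultimately show ?thesis unfolding P_def by (intro exI[of _ j] exI[of _ "c' j"]) simp
qed

lemma mem_unital_closed_subalgebra_generatedI:
  assumes "\<And>N. closed_subalgebra scaleR N \<Longrightarrow> G \<subseteq> N \<Longrightarrow> c \<in> adjoin_one N"
  shows "c \<in> unital_closed_subalgebra_generated sb G"
proof -
  have "c \<in> C" if C: "closed_subalgebra sb C" "1 \<in> C" "G \<subseteq> C" for C
  proof -
    have "closed_subalgebra scaleR C" using closed_subalgebra_real[OF algebra] C by blast
    then show ?thesis using assms[of C] adjoin_one_absorb closed_subalgebraD(2) C by blast
  qed
  then show ?thesis unfolding unital_closed_subalgebra_generated_def hull_def by blast
qed

lemma inverse_sequence:
  fixes Q :: "nat \<Rightarrow> nat set"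
  assumes r: "0 < r" "r < inverse (M + 1)" and Q: "\<And>k. finite (Q k)" and \<eta>: "\<eta> > 0"
  obtains idx :: "nat \<Rightarrow> 'i" and c :: "nat \<Rightarrow> 'b" where
    "\<And>k. convex_partial_sum r (e \<circ> idx) k * c k = 1"
    "\<And>k. c k * convex_partial_sum r (e \<circ> idx) k = 1"
    "\<And>k. norm (c k) \<le> (2 / (1 - r - r * M)) ^ k"
    "\<And>k. c k \<in> adjoin_one commuting_part"
    "\<And>k. c k \<in> unital_closed_subalgebra_generated sb ((e \<circ> idx) ` {1..k})"
    "\<And>k. idx k \<le> idx (Suc k)"
    "\<And>k. (\<nexists>m::'i. \<forall>i. i \<le> m) \<Longrightarrow> idx k < idx (Suc k)"
    "\<And>k n s. n \<in> Q k \<Longrightarrow> s \<in> T \<Longrightarrow> norm (\<sigma> (c (Suc k) ^ n) s - \<sigma> (c k ^ n) s) \<le> \<eta> / 2 ^ Suc k"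
proof -
  define L where "L = 2 / (1 - r - r * M)"
  have L: "L \<ge> 0"
    using r M_ge_1 by (simp add: L_def field_simps)
  \<comment> \<open>A state holds the current index, \<open>b_k\<close>, its inverse and the set
    \<open>G\<close> of elements used so far. Quantifying over all \<open>N\<close> containing
    \<open>G\<close> records where \<open>b_k - (1 - r)^k\<close> and the inverse lie.\<close>
  define P where "P k = (\<lambda>(i::'i, b, c, G). b * c = 1 \<and> c * b = 1 \<and> norm c \<le> L ^ k \<and> G \<subseteq> range e \<and>
    (\<forall>N. closed_subalgebra scaleR N \<longrightarrow> G \<subseteq> N \<longrightarrow> b - (1 - r) ^ k *\<^sub>R 1 \<in> N \<and> c \<in> adjoin_one N))" for k
  define R where "R k = (\<lambda>(i::'i, b, c, G) (j, b', c', G').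
    i \<le> j \<and> ((\<nexists>m::'i. \<forall>i. i \<le> m) \<longrightarrow> i < j) \<and>
    b' = b + (r * (1 - r) ^ k) *\<^sub>R (e j - 1) \<and> G' = insert (e j) G \<and>
    (\<forall>n\<in>Q k. \<forall>s\<in>T. norm (\<sigma> (c' ^ n) s - \<sigma> (c ^ n) s) \<le> \<eta> / 2 ^ Suc k))" for k
  have step: "\<exists>y. (P (Suc k) y) \<and> R k x y" if Pk: "P k x" for k x
  proof -
    obtain i b c G where x: "x = (i, b, c, G)" by (cases x)
    define t where "t = (1 - r) ^ k"
    define D where "D = b - t *\<^sub>R 1"
    have bc: "b * c = 1" "c * b = 1" and nc: "norm c \<le> L ^ k" and G: "G \<subseteq> range e"
      and N: "\<And>N. closed_subalgebra scaleR N \<Longrightarrow> G \<subseteq> N \<Longrightarrow> D \<in> N \<and> c \<in> adjoin_one N"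
      using Pk unfolding P_def x D_def t_def by auto
    have "G \<subseteq> commuting_part" using G e_in_commuting_part by blast
    then have "D \<in> commuting_part" "c \<in> adjoin_one commuting_part"
      using N closed_subalgebra_commuting_part by blast+
    moreover have "b = t *\<^sub>R 1 + D" by (simp add: D_def)
    ultimately obtain j c' where j: "i \<le> j" "(\<nexists>m::'i. \<forall>i. i \<le> m) \<longrightarrow> i < j"
      and c': "(b + (r * t) *\<^sub>R (e j - 1)) * c' = 1" "c' * (b + (r * t) *\<^sub>R (e j - 1)) = 1"
        "norm c' \<le> L * norm c"
      and N': "\<And>N. closed_subalgebra scaleR N \<Longrightarrow> e j \<in> N \<Longrightarrow> D \<in> N \<Longrightarrow> c \<in> adjoin_one N \<Longrightarrow> c' \<in> adjoin_one N"
      and close: "\<forall>n\<in>Q k. \<forall>s\<in>T. norm (\<sigma> (c' ^ n) s - \<sigma> (c ^ n) s) \<le> \<eta> / 2 ^ Suc k"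
      using extend_inverse[OF r _ bc _ _ Q, of t D "\<eta> / 2 ^ Suc k" i k] \<eta> unfolding L_def by auto
    have "norm c' \<le> L ^ Suc k"
      using c'(3) mult_left_mono[OF nc L] by simp
    \<comment> \<open>The unit component decreases from \<open>t\<close> to
      \<open>t - r t = (1 - r) ^ Suc k\<close>, so the invariant passes to the next stage.\<close>
    moreover have "b + (r * t) *\<^sub>R (e j - 1) - (1 - r) ^ Suc k *\<^sub>R 1 = D + (r * t) *\<^sub>R e j"
      by (simp add: D_def t_def algebra_simps)
    moreover have "D + (r * t) *\<^sub>R e j \<in> N" if "closed_subalgebra scaleR N" "insert (e j) G \<subseteq> N" for N
      using that N[of N] closed_subalgebraD(2)[of N] by (auto intro: subspace_add subspace_scale)
    moreover have "c' \<in> adjoin_one N" if "closed_subalgebra scaleR N" "insert (e j) G \<subseteq> N" for N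
      using that N[of N] N'[of N] by auto
    ultimately have "P (Suc k) (j, b + (r * t) *\<^sub>R (e j - 1), c', insert (e j) G)"
      using c' G unfolding P_def by auto
    moreover have "R k x (j, b + (r * t) *\<^sub>R (e j - 1), c', insert (e j) G)"
      using j close unfolding R_def x t_def by auto
    ultimately show ?thesis by blast
  qed
  \<comment> \<open>The start is pinned to \<open>b = 1\<close> and \<open>G = {}\<close>, because
    \<open>P 0\<close> alone admits other states. The initial index may be arbitrary: the partial
    sums begin at \<open>u 1\<close>.\<close>
  define P' where "P' k x \<longleftrightarrow> P k x \<and> (k = 0 \<longrightarrow> fst (snd x) = 1 \<and> snd (snd (snd x)) = {})" for k x
  have "\<exists>x. P' 0 x"
    by (rule exI[of _ "(undefined, 1, 1, {})"])
       (auto simp: P'_def P_def intro: one_in_adjoin_one subspace_0 closed_subalgebraD(2))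
  moreover have "\<exists>y. P' (Suc k) y \<and> R k x y" if "P' k x" for k x
    using step that unfolding P'_def by auto
  ultimately obtain f where f: "\<And>k. P' k (f k)" "\<And>k. R k (f k) (f (Suc k))"
    using dependent_nat_choice[of P' R] by blast
  define idx where "idx k = fst (f k)" for k
  define b where "b k = fst (snd (f k))" for k
  define c where "c k = fst (snd (snd (f k)))" for k
  define G where "G k = snd (snd (snd (f k)))" for k
  have fk: "f k = (idx k, b k, c k, G k)" for k
    by (simp add: idx_def b_def c_def G_def)
  have Pk: "P k (idx k, b k, c k, G k)" and 0: "b 0 = 1" "G 0 = {}" for k
    using f(1)[of k] f(1)[of 0] by (simp_all add: P'_def fk)
  have Rk: "R k (idx k, b k, c k, G k) (idx (Suc k), b (Suc k), c (Suc k), G (Suc k))" for k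
    using f(2)[of k] by (simp add: fk)
  have b: "b k = convex_partial_sum r (e \<circ> idx) k" for k
  proof (induction k)
    case (Suc k)
    have "b (Suc k) = b k + (r * (1 - r) ^ k) *\<^sub>R (e (idx (Suc k)) - 1)"
      using Rk[of k] unfolding R_def by simp
    then show ?case
      by (simp add: Suc convex_partial_sum_def algebra_simps)
  qed (simp add: 0 convex_partial_sum_def)
  have G: "G k = (e \<circ> idx) ` {1..k}" for k
  proof (induction k)
    case (Suc k)
    have "G (Suc k) = insert (e (idx (Suc k))) (G k)"
      using Rk[of k] unfolding R_def by simp
    then show ?case by (simp add: Suc atLeastAtMostSuc_conv)
  qed (simp add: 0)
  have Gsub: "G k \<subseteq> commuting_part" for k
    unfolding G using e_in_commuting_part by auto
  have cN: "c k \<in> adjoin_one N" if "closed_subalgebra scaleR N" "G k \<subseteq> N" for k N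
    using Pk[of k] that unfolding P_def by blast
  show ?thesis
  proof (rule that[of idx c])
    fix k
    show "convex_partial_sum r (e \<circ> idx) k * c k = 1" "c k * convex_partial_sum r (e \<circ> idx) k = 1"
      "norm (c k) \<le> (2 / (1 - r - r * M)) ^ k"
      using Pk[of k] unfolding P_def L_def b by auto
    show "c k \<in> adjoin_one commuting_part"
      using cN Gsub closed_subalgebra_commuting_part by blast
    show "c k \<in> unital_closed_subalgebra_generated sb ((e \<circ> idx) ` {1..k})"
      using cN mem_unital_closed_subalgebra_generatedI unfolding G by blast
    show "idx k \<le> idx (Suc k)" and "(\<nexists>m::'i. \<forall>i. i \<le> m) \<Longrightarrow> idx k < idx (Suc k)"
      using Rk[of k] unfolding R_def by auto
    show "norm (\<sigma> (c (Suc k) ^ n) s - \<sigma> (c k ^ n) s) \<le> \<eta> / 2 ^ Suc k"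
      if "n \<in> Q k" "s \<in> T" for n s
      using Rk[of k] that unfolding R_def by auto
  qed
qed

text \<open>
  At step \<open>k\<close> of the construction only the powers \<open>n \<in> Q k\<close> have to change little. A power that
  enters at step \<open>k + 1\<close> satisfies \<open>\<alpha> n \<ge> (\<parallel>\<sigma>\<parallel> + 1) L ^ (k + 1)\<close>, which leaves room for the norm
  bound \<open>L ^ (k + 1)\<close> of the inverse reached so far.
\<close>

theorem simultaneous_power_factorization_exists:
  fixes \<epsilon> \<delta> r :: real and n0 :: nat and \<alpha> :: "nat \<Rightarrow> real"
  assumes \<epsilon>: "\<epsilon> > 0" and \<delta>: "\<delta> > 0" and r: "0 < r" "r < inverse (M + 1)"
    and \<alpha>1: "\<And>n. n \<ge> 1 \<Longrightarrow> \<alpha> n > 1" and \<alpha>: "filterlim \<alpha> at_top sequentially"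
  shows "\<exists>a x. simultaneous_power_factorization sb sy A e M \<sigma> T \<epsilon> \<delta> r n0 \<alpha> a x"
proof -
  define L where "L = 2 / (1 - r - r * M)"
  have rM: "r * (M + 1) < 1" using r M_ge_1 by (simp add: field_simps)
  then have pos: "0 < 1 - r - r * M" by (simp add: distrib_left)
  have "0 \<le> r * M" using r M_ge_1 by simp
  then have r1: "r < 1" using pos by linarith
  have L: "L \<ge> 1" using pos r(1) \<open>0 \<le> r * M\<close> unfolding L_def by (subst le_divide_eq_1_pos) auto
  \<comment> \<open>The clause \<open>n \<le> n0 + k\<close> controls the powers up to
    \<open>n0\<close> from the start and every power \<open>n\<close> from stage \<open>n\<close> at
    the latest. The other clause adds only finitely many powers because \<open>\<alpha>\<close>
    tends to infinity.\<close>
  define Q where "Q k = {n. 1 \<le> n \<and> (n \<le> n0 + k \<or> \<alpha> n < (onorm \<sigma> + 1) * L ^ Suc k)}" for k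
  have Q_finite: "finite (Q k)" for k
  proof -
    obtain N where N: "\<And>n. n \<ge> N \<Longrightarrow> (onorm \<sigma> + 1) * L ^ Suc k \<le> \<alpha> n"
      using \<alpha> unfolding filterlim_at_top eventually_sequentially by blast
    have "Q k \<subseteq> {..max N (n0 + k)}"
      using N by (fastforce simp: Q_def le_max_iff_disj not_less[symmetric] intro: leI less_imp_le)
    then show ?thesis by (rule finite_subset) simp
  qed
  have Q_mono: "Q k \<subseteq> Q j" if "k \<le> j" for k j
  proof -
    have "(onorm \<sigma> + 1) * L ^ Suc k \<le> (onorm \<sigma> + 1) * L ^ Suc j"
      using L that onorm_\<sigma>_nonneg by (intro mult_left_mono power_increasing) auto
    then show ?thesis using that unfolding Q_def by auto
  qed
  have Q_self: "n \<in> Q n" if "n \<ge> 1" for n using that by (simp add: Q_def)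
  \<comment> \<open>The total movement allowed: \<open>\<epsilon>\<close> serves closeness for
    \<open>n \<le> n0\<close>, \<open>(\<alpha> n - 1) * \<delta>\<close> the growth bound for
    powers in \<open>Q 0\<close>, and \<open>\<delta>\<close> the growth bound for powers entering
    later.\<close>
  define \<eta> where "\<eta> = Min (insert \<epsilon> (insert \<delta> ((\<lambda>n. (\<alpha> n - 1) * \<delta>) ` Q 0)))"
  have fin: "finite (insert \<epsilon> (insert \<delta> ((\<lambda>n. (\<alpha> n - 1) * \<delta>) ` Q 0)))" using Q_finite by simp
  have \<eta>_le: "\<eta> \<le> \<epsilon>" "\<eta> \<le> \<delta>" "\<And>n. n \<in> Q 0 \<Longrightarrow> \<eta> \<le> (\<alpha> n - 1) * \<delta>"
    unfolding \<eta>_def by (rule Min_le[OF fin]; blast)+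
  have \<eta>: "\<eta> > 0"
    unfolding \<eta>_def using fin \<epsilon> \<delta> \<alpha>1 by (subst Min_gr_iff) (auto simp: Q_def)
  obtain idx c where
    bc: "\<And>k. convex_partial_sum r (e \<circ> idx) k * c k = 1"
    and cb: "\<And>k. c k * convex_partial_sum r (e \<circ> idx) k = 1"
    and nc: "\<And>k. norm (c k) \<le> L ^ k"
    and c_mem: "\<And>k. c k \<in> adjoin_one commuting_part"
    and c_gen: "\<And>k. c k \<in> unital_closed_subalgebra_generated sb ((e \<circ> idx) ` {1..k})"
    and idx_mono: "\<And>k. idx k \<le> idx (Suc k)"
    and idx_strict: "\<And>k. (\<nexists>m::'i. \<forall>i. i \<le> m) \<Longrightarrow> idx k < idx (Suc k)"
    and incr: "\<And>k n s. n \<in> Q k \<Longrightarrow> s \<in> T \<Longrightarrow> norm (\<sigma> (c (Suc k) ^ n) s - \<sigma> (c k ^ n) s) \<le> \<eta> / 2 ^ Suc k"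
    by (rule inverse_sequence[of r Q \<eta>, folded L_def, OF r Q_finite \<eta>]) (rule that)
  define u where "u = e \<circ> idx"
  define b where "b = convex_partial_sum r u"
  have nu: "norm (u i) \<le> M" for i by (simp add: u_def norm_e)
  obtain a where a_sums: "(\<lambda>i. (r * (1 - r) ^ i) *\<^sub>R u (Suc i)) sums a"
    and a_lim: "\<And>z. (\<lambda>k. (1 - r) ^ k *\<^sub>R z + (\<Sum>i=1..k. (r * (1 - r) ^ (i - 1)) *\<^sub>R u i)) \<longlonglongrightarrow> a"
    and a_hull: "a \<in> closure (convex hull (u ` {1..}))"
    using sums_convex_weights[of r u M] r(1) r1 nu by blast
  have b_lim: "b \<longlonglongrightarrow> a"
    unfolding b_def using a_lim[of 1] by (simp add: convex_partial_sum_def[abs_def])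
  have closure_sub: "closure (convex hull (u ` {1..})) \<subseteq> A \<inter> cball 0 M"
  proof (rule closure_minimal[OF hull_minimal])
    note A' = closed_subalgebraD[OF closed_subalgebra_real[OF algebra subalgebra]]
    show "u ` {1..} \<subseteq> A \<inter> cball 0 M" using nu e_mem by (auto simp: u_def)
    show "convex (A \<inter> cball 0 M)" using A'(2) by (intro convex_Int subspace_imp_convex convex_cball)
    show "closed (A \<inter> cball 0 M)" using A'(1) by (intro closed_Int closed_cball)
  qed
  define x where "x n s = lim (\<lambda>k. \<sigma> (c k ^ n) s)" for n s
  have incr': "norm (\<sigma> (c (Suc j) ^ n) s - \<sigma> (c j ^ n) s) \<le> \<eta> / 2 ^ Suc j"
    if "n \<in> Q k" "s \<in> T" "j \<ge> k" for n s j k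
    using incr Q_mono that by blast
  have x_lim: "(\<lambda>k. \<sigma> (c k ^ n) s) \<longlonglongrightarrow> x n s" if "n \<ge> 1" "s \<in> T" for n s
    unfolding x_def convergent_LIMSEQ_iff[symmetric]
    by (rule geometric_increments_converge(1)[OF incr'[OF Q_self[OF that(1)] that(2)]])
  have x_close: "norm (x n s - \<sigma> (c j ^ n) s) \<le> \<eta> / 2 ^ j" if "n \<in> Q k" "s \<in> T" "j \<ge> k" for n s j k
    unfolding x_def by (rule geometric_increments_converge(2)[OF incr'[OF that(1,2)] that(3)])
  have x_approx: "\<exists>k. \<forall>s\<in>T. norm (x n s - \<sigma> (c k ^ n) s) < \<zeta>" if "n \<ge> 1" "\<zeta> > 0" for n and \<zeta> :: real
  proof -
    have "(\<lambda>j. \<eta> / 2 ^ j) \<longlonglongrightarrow> 0"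
      using tendsto_mult_right_zero[OF LIMSEQ_inverse_realpow_zero[of 2], of \<eta>] by (simp add: divide_inverse)
    from order_tendstoD(2)[OF this \<open>\<zeta> > 0\<close>]
    have "\<forall>\<^sub>F j in sequentially. \<eta> / 2 ^ j < \<zeta> \<and> n \<le> j" using eventually_conj eventually_ge_at_top by blast
    then obtain j where j: "\<eta> / 2 ^ j < \<zeta>" "n \<le> j" unfolding eventually_sequentially by blast
    then show ?thesis using x_close[OF Q_self[OF that(1)] _ j(2)] by (intro exI[of _ j] ballI) (meson le_less_trans)
  qed
  have x_linear_approx: "\<exists>g. bounded_linear g \<and> (\<forall>s\<in>T. norm (x n s - g s) < \<zeta>)"
    if "n \<ge> 1" "\<zeta> > 0" for n and \<zeta> :: real
    using x_approx[OF that] blinfun.bounded_linear_right by blast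
  \<comment> \<open>Comparison with stage 0 is therefore comparison with \<open>s\<close>
    itself.\<close>
  have c0: "c 0 = 1" using bc[of 0] by (simp add: convex_partial_sum_def)
  have close0: "norm (x n s - s) \<le> \<eta>" if "n \<in> Q 0" "s \<in> T" for n s
    using x_close[OF that, of 0] by (simp add: c0 \<sigma>_one)
  have growth: "norm (x n s) \<le> \<alpha> n ^ n * max (norm s) \<delta>" if n: "n \<ge> 1" and s: "s \<in> T" for n s
  proof (cases "n \<in> Q 0")
    case True
    have "norm (x n s) \<le> norm s + norm (x n s - s)" using norm_triangle_ineq[of s "x n s - s"] by simp
    also have "\<dots> \<le> max (norm s) \<delta> + (\<alpha> n - 1) * max (norm s) \<delta>"
    proof (intro add_mono order_trans[OF close0[OF True s]] order_trans[OF \<eta>_le(3)[OF True]])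
      show "(\<alpha> n - 1) * \<delta> \<le> (\<alpha> n - 1) * max (norm s) \<delta>"
        using \<alpha>1[OF n] by (intro mult_left_mono) auto
    qed simp
    also have "\<dots> = \<alpha> n * max (norm s) \<delta>" by (simp add: algebra_simps)
    also have "\<dots> \<le> \<alpha> n ^ n * max (norm s) \<delta>"
      using \<alpha>1[OF n] n \<delta> by (intro mult_right_mono self_le_power) auto
    finally show ?thesis .
  next
    case False
    \<comment> \<open>\<open>k\<close> is the stage at which \<open>n\<close> enters. Being absent
      from \<open>Q j\<close> with \<open>k = Suc j\<close> forces \<open>\<alpha> n\<close> to
      dominate \<open>(onorm \<sigma> + 1) * L ^ k\<close>; from stage \<open>k\<close> on, the
      movement is at most \<open>\<eta> \<le> \<delta>\<close>.\<close>
    define k where "k = (LEAST k. n \<in> Q k)"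
    have k: "n \<in> Q k" unfolding k_def using Q_self[OF n] by (rule LeastI)
    then have "k \<noteq> 0" using False by (intro notI) simp
    then obtain j where j: "k = Suc j" using not0_implies_Suc by blast
    then have "n \<notin> Q j" using not_less_Least[of j "\<lambda>k. n \<in> Q k"] by (simp add: k_def)
    then have \<alpha>n: "(onorm \<sigma> + 1) * L ^ k \<le> \<alpha> n" using n unfolding Q_def j by auto
    define m where "m = max (norm s) \<delta>"
    have m: "norm s \<le> m" "\<delta> \<le> m" "0 \<le> m" using \<delta> by (auto simp: m_def)
    have Ln: "1 \<le> (L ^ k) ^ n" using L by (simp add: one_le_power)
    have "norm (x n s) \<le> norm (\<sigma> (c k ^ n) s) + norm (x n s - \<sigma> (c k ^ n) s)"
      using norm_triangle_ineq[of "\<sigma> (c k ^ n) s" "x n s - \<sigma> (c k ^ n) s"] by simp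
    also have "\<dots> \<le> onorm \<sigma> * (L ^ k) ^ n * m + (L ^ k) ^ n * m"
    proof (rule add_mono)
      have "norm (c k ^ n) \<le> (L ^ k) ^ n"
        by (rule order_trans[OF norm_power_ineq power_mono[OF nc]]) simp
      then have "onorm \<sigma> * norm (c k ^ n) * norm s \<le> onorm \<sigma> * (L ^ k) ^ n * m"
        using onorm_\<sigma>_nonneg m L by (intro mult_mono) auto
      then show "norm (\<sigma> (c k ^ n) s) \<le> onorm \<sigma> * (L ^ k) ^ n * m"
        using \<sigma>_bound order_trans by blast
      have "norm (x n s - \<sigma> (c k ^ n) s) \<le> \<eta> / 2 ^ k" by (rule x_close[OF k s order_refl])
      also have "\<dots> \<le> \<eta> / 1" using \<eta> by (intro divide_left_mono) auto
      also have "\<dots> \<le> 1 * m" using \<eta>_le(2) m by simp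
      also have "\<dots> \<le> (L ^ k) ^ n * m" using Ln m by (intro mult_right_mono)
      finally show "norm (x n s - \<sigma> (c k ^ n) s) \<le> (L ^ k) ^ n * m" .
    qed
    also have "\<dots> = (onorm \<sigma> + 1) * (L ^ k) ^ n * m" by (simp add: algebra_simps)
    also have "\<dots> \<le> (onorm \<sigma> + 1) ^ n * (L ^ k) ^ n * m"
      using onorm_\<sigma>_nonneg n m Ln by (intro mult_right_mono self_le_power) auto
    also have "\<dots> \<le> \<alpha> n ^ n * m"
      unfolding power_mult_distrib[symmetric]
      using onorm_\<sigma>_nonneg m L \<alpha>n by (intro mult_right_mono power_mono) auto
    finally show ?thesis unfolding m_def .
  qed
  have fact: "\<sigma> (a ^ n) (x n s) = s" if "n \<ge> 1" "s \<in> T" for n s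
  proof -
    \<comment> \<open>The approximating products all equal \<open>s\<close>, and both the operators
      and the vectors converge.\<close>
    have "(\<lambda>k. \<sigma> (b k ^ n) (\<sigma> (c k ^ n) s)) \<longlonglongrightarrow> \<sigma> (a ^ n) (x n s)"
      by (intro blinfun.tendsto x_lim that bounded_linear.tendsto[OF bounded_linear_\<sigma>] tendsto_power b_lim)
    moreover have "\<sigma> (b k ^ n) (\<sigma> (c k ^ n) s) = s" for k
    proof -
      have "b k ^ n * c k ^ n = 1" using bc[of k] by (intro left_right_inverse_power) (simp add: b_def u_def)
      then show ?thesis by (simp add: \<sigma>_one flip: \<sigma>_mult)
    qed
    ultimately show ?thesis by (simp add: LIMSEQ_const_iff)
  qed
  have unif: "uniformly_continuous_on T (x n)" if "n \<ge> 1" for n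
    by (rule uniformly_continuous_on_approx[OF x_linear_approx[OF that]])
  have "simultaneous_power_factorization sb sy A e M \<sigma> T \<epsilon> \<delta> r n0 \<alpha> a x"
  proof
    show "a \<in> A" and "norm a \<le> M" using a_hull closure_sub by auto
  next
    fix n :: nat and s assume "n \<ge> 1" "s \<in> T"
    then show "s = \<sigma> (a ^ n) (x n s)" and "norm (x n s) \<le> \<alpha> n ^ n * max (norm s) \<delta>"
      using fact growth by simp_all
  next
    fix n :: nat assume "n \<ge> 1"
    then show "uniformly_continuous_on T (x n)" by (rule unif)
  next
    fix n :: nat assume n: "n \<ge> 1"
    show "homeomorphism T (x n ` T) (x n) (\<sigma> (a ^ n))"
      unfolding homeomorphism_def
      using fact[OF n] uniformly_continuous_imp_continuous[OF unif[OF n]]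
      by (auto simp: image_image intro!: linear_continuous_on blinfun.bounded_linear_right)
  next
    fix n s assume "1 \<le> n" "n \<le> n0" "s \<in> T"
    then show "norm (s - x n s) \<le> \<epsilon>"
      using close0[of n s] \<eta>_le(1) by (simp add: Q_def norm_minus_commute)
  next
    fix n :: nat and s1 s2 assume n: "n \<ge> 1" and s: "s1 \<in> T" "s2 \<in> T" "s1 + s2 \<in> T"
    have "(\<lambda>k. \<sigma> (c k ^ n) (s1 + s2)) \<longlonglongrightarrow> x n s1 + x n s2"
      unfolding blinfun.add_right using n s by (intro tendsto_add x_lim)
    then show "x n (s1 + s2) = x n s1 + x n s2" by (rule LIMSEQ_unique[OF x_lim[OF n s(3)]])
  next
    fix n :: nat and \<mu> s assume n: "n \<ge> 1" and s: "s \<in> T" "sy \<mu> s \<in> T"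
    interpret Y: normed_space_over sy by (rule space)
    \<comment> \<open>Multiplication by a field scalar is continuous because \<open>sy\<close> is
      compatible with the norm; hence the passage through norms.\<close>
    have "(\<lambda>k. norm \<mu> * norm (\<sigma> (c k ^ n) s - x n s)) \<longlonglongrightarrow> norm \<mu> * 0"
      using LIM_zero[OF x_lim[OF n s(1)]] by (simp add: tendsto_mult_right_zero tendsto_norm_zero)
    then have "(\<lambda>k. sy \<mu> (\<sigma> (c k ^ n) s) - sy \<mu> (x n s)) \<longlonglongrightarrow> 0"
      by (subst tendsto_norm_zero_iff[symmetric]) (simp add: Y.norm_scale flip: Y.scale_right_diff_distrib)
    then have "(\<lambda>k. \<sigma> (c k ^ n) (sy \<mu> s)) \<longlonglongrightarrow> sy \<mu> (x n s)"
      by (simp add: \<sigma>_sy LIM_zero_cancel)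
    then show "x n (sy \<mu> s) = sy \<mu> (x n s)" by (rule LIMSEQ_unique[OF x_lim[OF n s(2)]])
  next
    have "convex_partial_sum r u k \<in> convex hull (insert 1 (u ` {1..k}))" for k
      unfolding convex_partial_sum_def using r(1) r1
      by (intro convex_weighted_sum_mem convex_convex_hull) (auto intro: hull_inc)
    then show "\<exists>u b_inv idx.
        ((\<lambda>i. (r * (1 - r) ^ i) *\<^sub>R u (Suc i)) sums a) \<and>
        a \<in> closure (convex hull (u ` {1..})) \<and>
        (\<forall>k. convex_partial_sum r u k \<in> convex hull (insert 1 (u ` {1..k})) \<and>
             convex_partial_sum r u k * b_inv k = 1 \<and> b_inv k * convex_partial_sum r u k = 1 \<and>
             b_inv k \<in> unital_closed_subalgebra_generated sb (u ` {1..k})) \<and>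
        (\<forall>n\<ge>1. \<forall>s\<in>T. (\<lambda>k. blinfun_apply (\<sigma> (b_inv k ^ n)) s) \<longlonglongrightarrow> x n s) \<and>
        (\<forall>k\<ge>1. u k = e (idx k)) \<and>
        (\<forall>k\<ge>1. idx k \<le> idx (Suc k)) \<and>
        ((\<nexists>m::'i. \<forall>i. i \<le> m) \<longrightarrow> (\<forall>k\<ge>1. idx k < idx (Suc k)))"
      using a_sums a_hull bc cb c_gen x_lim idx_mono idx_strict
      by (intro exI[of _ u] exI[of _ c] exI[of _ idx]) (auto simp: u_def)
  next
    fix n :: nat assume n: "n \<ge> 1" and "bounded T"
    then obtain B where B: "\<And>s. s \<in> T \<Longrightarrow> norm s \<le> B" unfolding bounded_iff by blast
    have "norm (x n s) \<le> \<alpha> n ^ n * max B \<delta>" if s: "s \<in> T" for s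
    proof -
      have "\<alpha> n ^ n * max (norm s) \<delta> \<le> \<alpha> n ^ n * max B \<delta>"
        using \<alpha>1[OF n] B[OF s] by (intro mult_left_mono) auto
      then show ?thesis using growth[OF n s] by linarith
    qed
    then show "bounded (x n ` T)" unfolding bounded_iff by blast
  next
    fix n :: nat assume "n \<ge> 1" "totally_bounded T"
    then show "totally_bounded (x n ` T)" using totally_bounded_image_approx x_linear_approx by blast
  next
    fix n :: nat assume n: "n \<ge> 1"
    \<comment> \<open>Replacing \<open>x n s\<close> by the approximant
      \<open>\<sigma> (c k ^ n) s\<close> costs at most \<open>K\<close> times their distance,
      uniformly in \<open>i\<close>; for the approximant the uniform limit is known.\<close>
    define K where "K = onorm \<sigma> * M + 1"
    have K: "K > 0" unfolding K_def using onorm_\<sigma>_nonneg M_ge_1 by (simp add: add_nonneg_pos)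
    show "uniform_limit T (\<lambda>i s. \<sigma> (e i) (x n s)) (x n) net_filter"
      unfolding uniform_limit_iff
    proof (intro allI impI)
      fix \<zeta> :: real assume \<zeta>: "\<zeta> > 0"
      then obtain k where k: "\<And>s. s \<in> T \<Longrightarrow> norm (x n s - \<sigma> (c k ^ n) s) < \<zeta> / (2 * K)"
        using x_approx[OF n, of "\<zeta> / (2 * K)"] K by auto
      have "c k ^ n \<in> adjoin_one commuting_part"
        by (intro adjoin_one_power closed_subalgebra_commuting_part c_mem)
      from uniform_limit_adjoin_one[OF this]
      have "\<forall>\<^sub>F i in net_filter. \<forall>s\<in>T. dist (\<sigma> (e i * c k ^ n) s) (\<sigma> (c k ^ n) s) < \<zeta> / 2"
        using \<zeta> unfolding uniform_limit_iff by (meson half_gt_zero)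
      then show "\<forall>\<^sub>F i in net_filter. \<forall>s\<in>T. dist (\<sigma> (e i) (x n s)) (x n s) < \<zeta>"
      proof (rule eventually_mono, intro ballI)
        fix i s
        assume i: "\<forall>s\<in>T. dist (\<sigma> (e i * c k ^ n) s) (\<sigma> (c k ^ n) s) < \<zeta> / 2" and s: "s \<in> T"
        define y where "y = \<sigma> (c k ^ n) s"
        have "norm (\<sigma> (e i) (x n s - y)) \<le> onorm \<sigma> * norm (e i) * norm (x n s - y)"
          by (rule \<sigma>_bound)
        also have "\<dots> \<le> onorm \<sigma> * M * norm (x n s - y)"
          using norm_e onorm_\<sigma>_nonneg by (intro mult_right_mono mult_left_mono) auto
        finally have "norm (\<sigma> (e i) (x n s - y)) + norm (x n s - y) \<le> K * norm (x n s - y)"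
          by (simp add: K_def algebra_simps)
        also have "\<dots> < K * (\<zeta> / (2 * K))" using k[OF s] K by (intro mult_strict_left_mono) (simp_all add: y_def)
        also have "\<dots> = \<zeta> / 2" using K by simp
        finally have 1: "norm (\<sigma> (e i) (x n s - y)) + norm (x n s - y) < \<zeta> / 2" .
        have 2: "norm (\<sigma> (e i) y - y) < \<zeta> / 2"
          using bspec[OF i s] by (simp add: y_def dist_norm \<sigma>_mult)
        have "norm (\<sigma> (e i) (x n s) - x n s) = norm ((\<sigma> (e i) (x n s - y) - (x n s - y)) + (\<sigma> (e i) y - y))"
          by (simp add: blinfun.diff_right)
        also have "\<dots> \<le> norm (\<sigma> (e i) (x n s - y) - (x n s - y)) + norm (\<sigma> (e i) y - y)"
          by (rule norm_triangle_ineq)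
        also have "\<dots> \<le> norm (\<sigma> (e i) (x n s - y)) + norm (x n s - y) + norm (\<sigma> (e i) y - y)"
          by (intro add_right_mono norm_triangle_ineq4)
        finally have "norm (\<sigma> (e i) (x n s) - x n s)
            \<le> norm (\<sigma> (e i) (x n s - y)) + norm (x n s - y) + norm (\<sigma> (e i) y - y)" .
        then show "dist (\<sigma> (e i) (x n s)) (x n s) < \<zeta>" using 1 2 by (simp add: dist_norm)
      qed
    qed
  qed
  then show ?thesis by blast
qed

end

section \<open>Transfer to spaces of bounded maps\<close>

lemma norm_sup_normed_le:
  assumes "sup_normed_space_of_bounded_maps sx sy ev" "\<And>w. norm (ev f w) \<le> B"
  shows "norm f \<le> B"
proof -
  have "norm f = (SUP w. norm (ev f w))"
    using assms(1) unfolding sup_normed_space_of_bounded_maps_def by blast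
  then show ?thesis using assms(2) by (auto intro: cSUP_least)
qed

lemma sup_normed_ev_diff:
  assumes "sup_normed_space_of_bounded_maps sx sy ev"
  shows "ev (f - g) w = ev f w - ev g w"
proof -
  have "ev (f - g + g) w = ev (f - g) w + ev g w"
    using assms unfolding sup_normed_space_of_bounded_maps_def by blast
  then show ?thesis by simp
qed

theorem theorem6p1:
  fixes sb :: "'k::real_normed_field \<Rightarrow> 'b::{real_normed_algebra_1, banach} \<Rightarrow> 'b"
    and sx :: "'k \<Rightarrow> 'x::banach \<Rightarrow> 'x"
    and sy :: "'k \<Rightarrow> 'y::banach \<Rightarrow> 'y"
    and A :: "'b set"
    and e :: "'i::preorder \<Rightarrow> 'b"
    and \<pi> :: "'b \<Rightarrow> 'x \<Rightarrow>\<^sub>L 'x"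
    and S :: "'x set"
    and ev :: "'y \<Rightarrow> 'w \<Rightarrow> 'x"
    and \<pi>' :: "'b \<Rightarrow> 'y \<Rightarrow>\<^sub>L 'y"
    and S' :: "'y set"
    and M \<epsilon> \<delta> r :: real
    and n0 :: nat
    and \<alpha> :: "nat \<Rightarrow> real"
  assumes "normed_algebra_over sb" and "closed_subalgebra sb A"
    and "M \<ge> 1" and "bounded_left_approximate_identity A e M"
    and "normed_space_over sx" and "continuous_representation sb A sx \<pi>"
    and "S \<noteq> {}"
    and "uniform_limit S (\<lambda>i s. blinfun_apply (\<pi> (e i)) s) (\<lambda>s. s) net_filter"
    and "bounded S \<or> (\<forall>i j. e i * e j = e j * e i)"
    and "normed_space_over sy" and "sup_normed_space_of_bounded_maps sx sy ev"
    and invariant: "\<And>a f. a \<in> A \<Longrightarrow> \<exists>g. \<forall>w. ev g w = blinfun_apply (\<pi> a) (ev f w)"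
    and "continuous_unital_representation sb sy \<pi>'"
    and extends: "\<And>a f w. a \<in> A \<Longrightarrow> ev (blinfun_apply (\<pi>' a) f) w = blinfun_apply (\<pi> a) (ev f w)"
    and "S' = {f. range (ev f) \<subseteq> S}" and "S' \<noteq> {}"
    and "\<epsilon> > 0" and "\<delta> > 0" and "0 < r" and "r < inverse (M + 1)" and "n0 \<ge> 1"
    and "\<And>n. n \<ge> 1 \<Longrightarrow> \<alpha> n > 1" and "filterlim \<alpha> at_top sequentially"
  shows "\<exists>a x. simultaneous_power_factorization sb sy A e M \<pi>' S' \<epsilon> \<delta> r n0 \<alpha> a x"
proof -
  note sup = \<open>sup_normed_space_of_bounded_maps sx sy ev\<close>
  have S': "ev f w \<in> S" if "f \<in> S'" for f w using that assms(15) by auto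
  have e_mem: "e i \<in> A" for i
    using assms(4) unfolding bounded_left_approximate_identity_def by blast
  have unif: "uniform_limit S' (\<lambda>i f. \<pi>' (e i) f) (\<lambda>f. f) net_filter"
    unfolding uniform_limit_iff
  proof (intro allI impI)
    fix \<zeta> :: real assume \<zeta>: "\<zeta> > 0"
    \<comment> \<open>Each value \<open>ev f w\<close> lies in \<open>S\<close>, so the estimate on
      \<open>S\<close> holds at all \<open>w\<close> simultaneously. Halving \<open>\<zeta>\<close>
      restores strictness after the supremum is taken.\<close>
    then have "\<forall>\<^sub>F i in net_filter. \<forall>s\<in>S. dist (\<pi> (e i) s) s < \<zeta> / 2"
      using assms(8) unfolding uniform_limit_iff by (meson half_gt_zero)
    then show "\<forall>\<^sub>F i in net_filter. \<forall>f\<in>S'. dist (\<pi>' (e i) f) f < \<zeta>"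
    proof (rule eventually_mono, intro ballI)
      fix i f assume i: "\<forall>s\<in>S. dist (\<pi> (e i) s) s < \<zeta> / 2" and f: "f \<in> S'"
      have "norm (ev (\<pi>' (e i) f - f) w) \<le> \<zeta> / 2" for w
        using bspec[OF i S'[OF f, of w]]
        by (simp add: sup_normed_ev_diff[OF sup] extends[OF e_mem] dist_norm)
      then have "norm (\<pi>' (e i) f - f) \<le> \<zeta> / 2" by (rule norm_sup_normed_le[OF sup])
      then show "dist (\<pi>' (e i) f) f < \<zeta>" using \<zeta> by (simp add: dist_norm)
    qed
  qed
  have bdd_or_comm: "bounded S' \<or> (\<forall>i j. e i * e j = e j * e i)"
  proof (cases "bounded S")
    case True
    then obtain B where "\<And>s. s \<in> S \<Longrightarrow> norm s \<le> B" unfolding bounded_iff by blast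
    then have "norm f \<le> B" if "f \<in> S'" for f using S'[OF that] by (blast intro: norm_sup_normed_le[OF sup])
    then show ?thesis unfolding bounded_iff by blast
  qed (use assms(9) in blast)
  interpret uniformly_approximated_set sb sy A e M \<pi>' S'
    by (rule uniformly_approximated_set.intro[OF assms(1,10,2-4,13) unif bdd_or_comm])
  show ?thesis by (rule simultaneous_power_factorization_exists[OF assms(17-20,22,23)])
qed

end
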